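(* For each $n\ge2$ let $X=X^{(n)}$ be a random variable with values in $\{2,\dots,n\}$, let $Y$ be its size-biased version, $\mu=\mathbb E[\log Y]$ and $\sigma^2=\mathrm{Var}(\log Y)$, $\sigma\ge0$. Assume that, as $n\to\infty$, $\mu/\log n\to0$ and $\sigma^2/(\mu\log n)\to0$. Then the quantity $$t_{\rm w}=\Big(1+\frac{\sigma}{\mu}\Big)\frac{n\sqrt{\log n}}{\mathbb E[X]\sqrt{\mu}}$$ satisfies $t_{\rm w}/t_{\rm ent}\to0$, where $t_{\rm ent}=\frac{n\log n}{\mathbb E[X\log X]}=\frac{n\log n}{\mathbb E[X]\,\mu}$, and, for the $X$-Block Average process started from a Dirac mass, for every $\varepsilon\in(0,\frac12)$ the ratio $$\frac{t_{\rm mix}(\varepsilon)-t_{\rm mix}(1-\varepsilon)}{t_{\rm w}}$$ stays bounded as $n\to\infty$.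
   Context: Let $V=\{1,\dots,n\}$ and let $\Delta$ be the set of probability vectors on $V$. For $A\subset V$ and $\eta\in\Delta$, let $\varPsi_A\eta(x)=\frac1{|A|}\sum_{y\in A}\eta(y)$ if $x\in A$ and $\varPsi_A\eta(x)=\eta(x)$ if $x\notin A$. Given the law of $X$ (which may depend on $n$), let $X_1,X_2,\dots$ be i.i.d. copies of $X$ and, independently for each $t$, given $X_t$ let $A_t$ be a uniformly random subset of $V$ with $|A_t|=X_t$. The $X$-Block Average process started from $\eta_0$ is $\eta_t=\varPsi_{A_t}\cdots\varPsi_{A_1}\eta_0$; here $\eta_0$ is the Dirac mass at some $x_0\in V$. Let $\pi(x)\equiv 1/n$, $\|v\|_{\rm TV}=\frac12\sum_{x\in V}|v(x)|$, $d_{\rm TV}(t)=\|\eta_t-\pi\|_{\rm TV}$ (a random variable), and $t_{\rm mix}(\varepsilon)=\inf\{t\in\mathbb N:\ \mathbb E[d_{\rm TV}(t)]<\varepsilon\}$. The size-biased version $Y$ of $X$ has law $\mathbb P(Y=k)=k\,\mathbb P(X=k)/\mathbb E[X]$, $k\in\{2,\dots,n\}$, so that $\mu=\mathbb E[X\log X]/\mathbb E[X]$ and $\sigma^2=\mathbb E[X(\log X)^2]/\mathbb E[X]-\mu^2$. Logarithms are natural; $X$, $Y$, $\mu$, $\sigma$ all may depend on $n$. *)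

theory Defs
  imports "HOL-Probability.Probability"
begin

definition mean :: "nat pmf \<Rightarrow> real" where
  "mean X = measure_pmf.expectation X real"

text \<open>
  Laws of random variables are represented by \<^typ>\<open>nat pmf\<close>. The weights below sum to one
  whenever the mean is finite and positive; see \<open>pmf_size_biased\<close>.
\<close>

definition size_biased :: "nat pmf \<Rightarrow> nat pmf" where
  "size_biased X = embed_pmf (\<lambda>k. real k * pmf X k / mean X)"

definition mu_Y :: "nat pmf \<Rightarrow> real" where
  "mu_Y X = measure_pmf.expectation (size_biased X) (\<lambda>k. ln (real k))"

definition sigma_Y :: "nat pmf \<Rightarrow> real" where
  "sigma_Y X = sqrt (measure_pmf.variance (size_biased X) (\<lambda>k. ln (real k)))"

definition t_ent :: "nat \<Rightarrow> nat pmf \<Rightarrow> real" where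
  "t_ent n X = real n * ln (real n) / measure_pmf.expectation X (\<lambda>k. real k * ln (real k))"

definition t_w :: "nat \<Rightarrow> nat pmf \<Rightarrow> real" where
  "t_w n X = (1 + sigma_Y X / mu_Y X) * (real n * sqrt (ln (real n)) / (mean X * sqrt (mu_Y X)))"

text \<open>
  Vectors on \<open>V = {1..n}\<close> are functions \<^typ>\<open>nat \<Rightarrow> real\<close>, whose values outside \<open>V\<close>
  play no role.
\<close>

definition block_avg :: "nat set \<Rightarrow> (nat \<Rightarrow> real) \<Rightarrow> nat \<Rightarrow> real" where
  "block_avg A \<eta> x = (if x \<in> A then (\<Sum>y\<in>A. \<eta> y) / real (card A) else \<eta> x)"

definition block_law :: "nat \<Rightarrow> nat pmf \<Rightarrow> nat set pmf" where
  "block_law n X = bind_pmf X (\<lambda>k. pmf_of_set {A. A \<subseteq> {1..n} \<and> card A = k})"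

text \<open>
  The space of block sequences \<open>A\<^sub>1, A\<^sub>2, \<dots>\<close>. As the pairs \<open>(X\<^sub>t, A\<^sub>t)\<close> are i.i.d., the blocks
  are i.i.d. with law \<^term>\<open>block_law n X\<close>, and \<open>X\<^sub>t\<close> is recovered as the size of \<open>A\<^sub>t\<close>.
\<close>

definition block_space :: "nat \<Rightarrow> nat pmf \<Rightarrow> (nat \<Rightarrow> nat set) measure" where
  "block_space n X = Pi\<^sub>M {1..} (\<lambda>_. measure_pmf (block_law n X))"

primrec block_process :: "(nat \<Rightarrow> real) \<Rightarrow> (nat \<Rightarrow> nat set) \<Rightarrow> nat \<Rightarrow> nat \<Rightarrow> real" where
  "block_process \<eta>0 A 0 = \<eta>0"
| "block_process \<eta>0 A (Suc t) = block_avg (A (Suc t)) (block_process \<eta>0 A t)"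

definition tv_norm :: "nat \<Rightarrow> (nat \<Rightarrow> real) \<Rightarrow> real" where
  "tv_norm n v = (1/2) * (\<Sum>x\<in>{1..n}. \<bar>v x\<bar>)"

definition dirac :: "nat \<Rightarrow> nat \<Rightarrow> real" where
  "dirac x0 = indicator {x0}"

definition d_TV :: "nat \<Rightarrow> nat \<Rightarrow> (nat \<Rightarrow> nat set) \<Rightarrow> nat \<Rightarrow> real" where
  "d_TV n x0 A t = tv_norm n (\<lambda>x. block_process (dirac x0) A t x - 1 / real n)"

text \<open>
  The infimum is taken in \<^typ>\<open>nat\<close>. For blocks of size at least two the expected distance
  tends to zero, so for \<open>\<epsilon> > 0\<close> the set is nonempty.
\<close>

definition t_mix :: "nat \<Rightarrow> nat pmf \<Rightarrow> nat \<Rightarrow> real \<Rightarrow> nat" where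
  "t_mix n X x0 \<epsilon> =
     Inf {t. (\<integral>A. d_TV n x0 A t \<partial>block_space n X) < \<epsilon>}"

lemma mean_pos:
  assumes "n \<ge> 2" "set_pmf X \<subseteq> {2..n}"
  shows "mean X > 0"
proof -
  have "finite (set_pmf X)" using assms finite_subset by blast
  then have i: "integrable (measure_pmf X) real" by (rule integrable_measure_pmf_finite)
  have "measure_pmf.expectation X (\<lambda>_. 2) \<le> measure_pmf.expectation X real"
    using assms by (intro integral_mono_AE i) (auto simp: AE_measure_pmf_iff)
  then show ?thesis by (simp add: mean_def)
qed

lemma pmf_size_biased:
  assumes "n \<ge> 2" "set_pmf X \<subseteq> {2..n}"
  shows "pmf (size_biased X) k = real k * pmf X k / mean X"
proof -
  have fin: "finite (set_pmf X)" using assms finite_subset by blast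
  have pos: "mean X > 0" by (rule mean_pos[OF assms])
  have m: "mean X = (\<Sum>k\<in>set_pmf X. real k * pmf X k)"
    unfolding mean_def using fin by (subst integral_measure_pmf[of "set_pmf X"]) (auto simp: mult.commute)
  let ?f = "\<lambda>k. real k * pmf X k / mean X"
  have "(\<integral>\<^sup>+k. ennreal (?f k) \<partial>count_space UNIV) = (\<Sum>k\<in>set_pmf X. ennreal (?f k))"
    using fin by (intro nn_integral_count_space') (auto simp: set_pmf_iff)
  also have "\<dots> = ennreal (\<Sum>k\<in>set_pmf X. ?f k)"
    using pos by (intro sum_ennreal) auto
  also have "(\<Sum>k\<in>set_pmf X. ?f k) = 1"
    using pos m by (simp add: sum_divide_distrib[symmetric])
  finally show ?thesis unfolding size_biased_def
    using pos by (intro pmf_embed_pmf) auto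
qed

lemma expectation_size_biased:
  fixes f :: "nat \<Rightarrow> real"
  assumes "n \<ge> 2" "set_pmf X \<subseteq> {2..n}"
  shows "measure_pmf.expectation (size_biased X) f
         = measure_pmf.expectation X (\<lambda>k. real k * f k) / mean X"
proof -
  have fin: "finite (set_pmf X)" using assms finite_subset by blast
  have s: "set_pmf (size_biased X) \<subseteq> set_pmf X"
    by (auto simp: set_pmf_iff pmf_size_biased[OF assms])
  have "measure_pmf.expectation (size_biased X) f
        = (\<Sum>k\<in>set_pmf X. pmf (size_biased X) k *\<^sub>R f k)"
    using fin s by (intro integral_measure_pmf) auto
  also have "\<dots> = (\<Sum>k\<in>set_pmf X. pmf X k *\<^sub>R (real k * f k)) / mean X"
    by (simp add: pmf_size_biased[OF assms] sum_divide_distrib mult_ac)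
  also have "(\<Sum>k\<in>set_pmf X. pmf X k *\<^sub>R (real k * f k))
             = measure_pmf.expectation X (\<lambda>k. real k * f k)"
    using fin by (intro integral_measure_pmf[symmetric]) auto
  finally show ?thesis .
qed

lemma t_ent_eq:
  assumes "n \<ge> 2" "set_pmf X \<subseteq> {2..n}"
  shows "t_ent n X = real n * ln (real n) / (mean X * mu_Y X)"
  using mean_pos[OF assms] by (simp add: t_ent_def mu_Y_def expectation_size_biased[OF assms])

lemma measurable_block_process:
  "(\<lambda>A. block_process \<eta>0 A t x) \<in> borel_measurable (block_space n X)"
proof (induction t arbitrary: x)
  case (Suc t)
  let ?B = "\<lambda>A::nat \<Rightarrow> nat set. if finite (A (Suc t)) then A (Suc t) else {}"
  have c: "(\<lambda>A. A (Suc t)) \<in> block_space n X \<rightarrow>\<^sub>M measure_pmf (block_law n X)"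
    unfolding block_space_def by (rule measurable_component_singleton) simp
  have g: "?B \<in> block_space n X \<rightarrow>\<^sub>M count_space {F. finite F}"
    by (rule measurable_compose[OF c, where g = "\<lambda>a. if finite a then a else {}"])
       (simp add: Pi_iff)
  have "(\<lambda>A. (\<Sum>y\<in>?B A. block_process \<eta>0 A t y) / real (card (?B A)))
          \<in> borel_measurable (block_space n X)"
    by (rule measurable_compose_countable'[OF _ g]) (auto intro!: Suc borel_measurable_divide 
         borel_measurable_sum countable_Collect_finite)
  moreover have "(\<Sum>y\<in>?B A. block_process \<eta>0 A t y) / real (card (?B A))
      = (\<Sum>y\<in>A (Suc t). block_process \<eta>0 A t y) / real (card (A (Suc t)))" for A by simp
  ultimately have a: "(\<lambda>A. (\<Sum>y\<in>A (Suc t). block_process \<eta>0 A t y) / real (card (A (Suc t))))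
          \<in> borel_measurable (block_space n X)" by simp
  have p: "Measurable.pred (block_space n X) (\<lambda>A. x \<in> A (Suc t))"
    by (rule measurable_compose[OF c]) (unfold measurable_pmf_measure1, simp)
  show ?case
    unfolding block_process.simps block_avg_def by (rule measurable_If[OF a Suc]) (use p in simp)
qed simp

lemma measurable_d_TV: "(\<lambda>A. d_TV n x0 A t) \<in> borel_measurable (block_space n X)"
  unfolding d_TV_def tv_norm_def
  by (intro borel_measurable_times borel_measurable_sum borel_measurable_abs
      borel_measurable_diff measurable_block_process) auto

end

theory Submission
  imports Defs
begin

text \<open>
  The unit mass at \<open>x\<^sub>0\<close> is followed as a list of pieces \<open>(z, w)\<close> of weight \<open>w\<close> located at \<open>z\<close>:
  a block \<open>A\<close> containing \<open>z\<close> breaks the piece into \<open>|A|\<close> equal ones. For a piece chosen with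
  probability equal to its weight, \<open>- ln w\<close> is a sum of \<open>t\<close> i.i.d. increments whose mean
  \<open>c\<^sub>1 = E[X ln X] / n\<close> and second moment \<open>c\<^sub>2 = E[X (ln X)\<^sup>2] / n\<close> satisfy \<open>t\<^sub>e\<^sub>n\<^sub>t c\<^sub>1 = ln n\<close> and
  \<open>t\<^sub>e\<^sub>n\<^sub>t c\<^sub>2 \<le> (t\<^sub>w c\<^sub>1)\<^sup>2\<close>. By Chebyshev's inequality almost all of the mass is therefore in pieces
  much heavier than \<open>1/n\<close> at time \<open>t\<^sub>e\<^sub>n\<^sub>t - C t\<^sub>w\<close>, and in pieces much lighter than \<open>1/n\<close> at time
  \<open>t\<^sub>e\<^sub>n\<^sub>t + C t\<^sub>w\<close>.

  In the first case the heavy pieces occupy few sites, so the distance to equilibrium is near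
  one. In the second case the square norm of the light part is at most the contribution of
  single pieces, which is \<open>o(1/n)\<close>, plus that of pairs of distinct pieces at a common site. The
  expectations of \<open>\<Sum>\<^sub>x \<eta>\<^sub>t(x)\<^sup>2\<close> and of \<open>\<Sum> w\<^sup>2\<close> satisfy exact linear recursions, and their
  difference, the contribution of such pairs, is at most \<open>1/n\<close>. So the light part is close to
  the uniform distribution in the square norm, hence in total variation.
\<close>

section \<open>Finite expectations and random blocks\<close>

text \<open>Removing \<open>P\<close> is a bijection onto the subsets of \<open>V - P\<close> with
  \<open>k - card P\<close> elements.\<close>

lemma block_sets_with_subset:
  fixes V P :: "'a set"
  assumes "finite V" "P \<subseteq> V" "card P \<le> k"
  shows "card {A. A \<subseteq> V \<and> card A = k \<and> P \<subseteq> A} = (card V - card P) choose (k - card P)"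
proof -
  have fP: "finite P" using assms finite_subset by blast
  have "bij_betw (\<lambda>B. B \<union> P) {B. B \<subseteq> V - P \<and> card B = k - card P}
          {A. A \<subseteq> V \<and> card A = k \<and> P \<subseteq> A}"
  proof (rule bij_betw_byWitness[where f' = "\<lambda>A. A - P"])
    show "(\<lambda>B. B \<union> P) ` {B. B \<subseteq> V - P \<and> card B = k - card P} \<subseteq> {A. A \<subseteq> V \<and> card A = k \<and> P \<subseteq> A}"
    proof clarsimp
      fix B assume B: "B \<subseteq> V - P" "card B = k - card P"
      have "finite B" using B(1) assms(1) by (meson finite_Diff finite_subset)
      then have "card (B \<union> P) = card B + card P" using B fP by (intro card_Un_disjoint) auto
      then show "B \<subseteq> V \<and> P \<subseteq> V \<and> card (B \<union> P) = k" using B assms by auto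
    qed
    show "(\<lambda>A. A - P) ` {A. A \<subseteq> V \<and> card A = k \<and> P \<subseteq> A} \<subseteq> {B. B \<subseteq> V - P \<and> card B = k - card P}"
      using fP by (auto simp: card_Diff_subset)
  qed auto
  then have "card {A. A \<subseteq> V \<and> card A = k \<and> P \<subseteq> A} = card {B. B \<subseteq> V - P \<and> card B = k - card P}"
    by (simp add: bij_betw_same_card)
  also have "\<dots> = (card V - card P) choose (k - card P)"
    using assms fP by (subst n_subsets) (auto simp: card_Diff_subset)
  finally show ?thesis .
qed

lemma expectation_sum_list:
  fixes F :: "'b \<Rightarrow> 'a \<Rightarrow> real"
  assumes "finite (set_pmf P)"
  shows "measure_pmf.expectation P (\<lambda>x. \<Sum>p\<leftarrow>ps. F p x) = (\<Sum>p\<leftarrow>ps. measure_pmf.expectation P (F p))"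
  by (induction ps) (simp_all add: integrable_measure_pmf_finite assms)

lemma expectation_mono_finite:
  fixes f g :: "'a \<Rightarrow> real"
  assumes "finite (set_pmf P)" "\<And>x. x \<in> set_pmf P \<Longrightarrow> f x \<le> g x"
  shows "measure_pmf.expectation P f \<le> measure_pmf.expectation P g"
  using assms by (intro integral_mono_AE) (auto simp: AE_measure_pmf_iff integrable_measure_pmf_finite)

lemma expectation_cong_pmf:
  fixes f g :: "'a \<Rightarrow> real"
  assumes "\<And>x. x \<in> set_pmf P \<Longrightarrow> f x = g x"
  shows "measure_pmf.expectation P f = measure_pmf.expectation P g"
  using assms by (intro integral_cong_AE) (auto simp: AE_measure_pmf_iff)

lemma expectation_affine:
  fixes f :: "'a \<Rightarrow> real"
  assumes "finite (set_pmf P)"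
  shows "measure_pmf.expectation P (\<lambda>x. a * f x + c) = a * measure_pmf.expectation P f + c"
  using assms by (simp add: integrable_measure_pmf_finite)

lemma expectation_bind_finite:
  fixes h :: "'b \<Rightarrow> real"
  assumes "finite (set_pmf P)" "\<And>x. x \<in> set_pmf P \<Longrightarrow> finite (set_pmf (f x))"
  shows "measure_pmf.expectation (bind_pmf P f) h = measure_pmf.expectation P (\<lambda>x. measure_pmf.expectation (f x) h)"
  using assms by (subst pmf_expectation_bind[of "set_pmf P"])
    (auto simp: integral_measure_pmf[of "set_pmf P"])

section \<open>Inclusion probabilities under a random block\<close>

locale block_average =
  fixes n :: nat and X :: "nat pmf"
  assumes n2: "n \<ge> 2" and X_range: "set_pmf X \<subseteq> {2..n}"
begin

lemma finite_X: "finite (set_pmf X)"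
  using X_range finite_subset by blast

lemma finite_blocks: "finite {A. A \<subseteq> {1..n} \<and> card A = k}"
  by (rule finite_subset[of _ "Pow {1..n}"]) auto

lemma blocks_nonempty: "k \<le> n \<Longrightarrow> {A. A \<subseteq> {1..n} \<and> card A = k} \<noteq> {}"
  using obtain_subset_with_card_n[of k "{1..n}"] by fastforce

lemma set_block_law:
  assumes "B \<in> set_pmf (block_law n X)"
  shows "B \<subseteq> {1..n}" "finite B" "card B \<in> set_pmf X" "card B \<ge> 2"
proof -
  from assms obtain k where k: "k \<in> set_pmf X" "B \<in> set_pmf (pmf_of_set {A. A \<subseteq> {1..n} \<and> card A = k})"
    unfolding block_law_def by auto
  then have "k \<le> n" using X_range by auto
  with k(2) have B: "B \<subseteq> {1..n}" "card B = k"
    using set_pmf_of_set[OF blocks_nonempty finite_blocks] by auto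
  then show "B \<subseteq> {1..n}" "finite B" "card B \<in> set_pmf X" "card B \<ge> 2"
    using k X_range finite_subset by auto
qed

lemma finite_block_law: "finite (set_pmf (block_law n X))"
proof (rule finite_subset)
  show "set_pmf (block_law n X) \<subseteq> Pow {1..n}"
    by (intro subsetI PowI set_block_law(1))
qed simp

lemma integrable_block_law [simp]: "integrable (measure_pmf (block_law n X)) (f :: _ \<Rightarrow> real)"
  by (rule integrable_measure_pmf_finite[OF finite_block_law])

lemma integrable_X [simp]: "integrable (measure_pmf X) (f :: _ \<Rightarrow> real)"
  by (rule integrable_measure_pmf_finite[OF finite_X])

lemma expectation_block_law:
  fixes f :: "nat set \<Rightarrow> real"
  shows "measure_pmf.expectation (block_law n X) f =
    measure_pmf.expectation X (\<lambda>k. (\<Sum>A | A \<subseteq> {1..n} \<and> card A = k. f A) / real (n choose k))"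
proof -
  have *: "set_pmf (pmf_of_set {A. A \<subseteq> {1..n} \<and> card A = k}) = {A. A \<subseteq> {1..n} \<and> card A = k}"
    "{A. A \<subseteq> {1..n} \<and> card A = k} \<noteq> {}" if "k \<in> set_pmf X" for k
  proof -
    show ne: "{A. A \<subseteq> {1..n} \<and> card A = k} \<noteq> {}"
      using that X_range by (intro blocks_nonempty) auto
    show "set_pmf (pmf_of_set {A. A \<subseteq> {1..n} \<and> card A = k}) = {A. A \<subseteq> {1..n} \<and> card A = k}"
      by (rule set_pmf_of_set[OF ne finite_blocks])
  qed
  show ?thesis
    unfolding block_law_def using * finite_blocks
    by (subst expectation_bind_finite[OF finite_X])
      (auto intro!: expectation_cong_pmf simp: integral_pmf_of_set n_subsets)
qed

text \<open>Applied to singletons and pairs: \<open>card P \<le> 2\<close> guarantees that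
  \<open>P\<close> fits into every block, since blocks have at least two elements.\<close>

lemma expectation_block_containing:
  fixes h :: "nat \<Rightarrow> real"
  assumes "P \<subseteq> {1..n}" "card P \<le> 2"
  shows "measure_pmf.expectation (block_law n X) (\<lambda>B. if P \<subseteq> B then h (card B) else 0) =
    measure_pmf.expectation X (\<lambda>k. real ((n - card P) choose (k - card P)) / real (n choose k) * h k)"
proof -
  have "(\<Sum>A | A \<subseteq> {1..n} \<and> card A = k. if P \<subseteq> A then h (card A) else 0)
      = real ((n - card P) choose (k - card P)) * h k" if "k \<in> set_pmf X" for k
  proof -
    have "(\<Sum>A | A \<subseteq> {1..n} \<and> card A = k. if P \<subseteq> A then h (card A) else 0)
       = (\<Sum>A | A \<subseteq> {1..n} \<and> card A = k \<and> P \<subseteq> A. h (card A))"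
      by (rule sum.mono_neutral_cong_right[OF finite_blocks]) auto
    also have "\<dots> = real (card {A. A \<subseteq> {1..n} \<and> card A = k \<and> P \<subseteq> A}) * h k" by simp
    also have "card {A. A \<subseteq> {1..n} \<and> card A = k \<and> P \<subseteq> A} = (n - card P) choose (k - card P)"
      using assms that X_range by (subst block_sets_with_subset) auto
    finally show ?thesis .
  qed
  then show ?thesis unfolding expectation_block_law by (intro expectation_cong_pmf) simp
qed

text \<open>Given its size \<open>k\<close>, a block contains \<open>z\<close> with probability
  \<open>k / n\<close>. The factor \<open>k\<close> is the origin of the size-biased law.\<close>

lemma expectation_block_mem:
  fixes h :: "nat \<Rightarrow> real"
  assumes "z \<in> {1..n}"
  shows "measure_pmf.expectation (block_law n X) (\<lambda>B. if z \<in> B then h (card B) else 0) =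
    measure_pmf.expectation X (\<lambda>k. real k * h k) / real n"
proof -
  have "real ((n - 1) choose (k - 1)) / real (n choose k) = real k / real n" if "k \<in> set_pmf X" for k
  proof -
    have k: "2 \<le> k" "k \<le> n" using that X_range by auto
    have "k * (n choose k) = n * ((n - 1) choose (k - 1))"
      using k times_binomial_minus1_eq by simp
    then have "real k * real (n choose k) = real n * real ((n - 1) choose (k - 1))"
      by (metis of_nat_mult)
    moreover have "real (n choose k) > 0" using k by simp
    ultimately show ?thesis using n2 by (simp add: field_simps)
  qed
  then have "measure_pmf.expectation X (\<lambda>k. real ((n - 1) choose (k - 1)) / real (n choose k) * h k)
     = measure_pmf.expectation X (\<lambda>k. real k * h k / real n)"
    by (intro expectation_cong_pmf) (simp)
  then show ?thesis
    using expectation_block_containing[of "{z}" h] assms by simp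
qed

lemma expectation_block_mem2:
  fixes h :: "nat \<Rightarrow> real"
  assumes "z \<in> {1..n}" "y \<in> {1..n}" "z \<noteq> y"
  shows "measure_pmf.expectation (block_law n X) (\<lambda>B. if z \<in> B \<and> y \<in> B then h (card B) else 0) =
    measure_pmf.expectation X (\<lambda>k. real k * (real k - 1) * h k) / (real n * (real n - 1))"
proof -
  have "real ((n - 2) choose (k - 2)) / real (n choose k) = real k * (real k - 1) / (real n * (real n - 1))"
    if "k \<in> set_pmf X" for k
  proof -
    have k: "2 \<le> k" "k \<le> n" using that X_range by auto
    have "k * (n choose k) = n * ((n - 1) choose (k - 1))"
      using k times_binomial_minus1_eq by simp
    then have 1: "real k * real (n choose k) = real n * real ((n - 1) choose (k - 1))"
      by (metis of_nat_mult)
    have "(k - 1) * ((n - 1) choose (k - 1)) = (n - 1) * ((n - 2) choose (k - 2))"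
      using k times_binomial_minus1_eq[of "k - 1" "n - 1"] by (simp add: numeral_2_eq_2)
    then have "real (k - 1) * real ((n - 1) choose (k - 1)) = real (n - 1) * real ((n - 2) choose (k - 2))"
      by (metis of_nat_mult)
    then have 2: "(real k - 1) * real ((n - 1) choose (k - 1)) = (real n - 1) * real ((n - 2) choose (k - 2))"
      using k by simp
    have "real k * (real k - 1) * real (n choose k) = (real k - 1) * (real n * real ((n - 1) choose (k - 1)))"
      using 1 by simp
    also have "\<dots> = real n * (real n - 1) * real ((n - 2) choose (k - 2))" using 2 by simp
    finally have "real k * (real k - 1) * real (n choose k) = real n * (real n - 1) * real ((n - 2) choose (k - 2))" .
    moreover have "real (n choose k) > 0" using k by simp
    moreover have "real n * (real n - 1) > 0" using n2 by simp
    ultimately show ?thesis using n2 by (subst frac_eq_eq) (auto simp: mult.commute)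
  qed
  then have "measure_pmf.expectation X (\<lambda>k. real ((n - 2) choose (k - 2)) / real (n choose k) * h k)
     = measure_pmf.expectation X (\<lambda>k. real k * (real k - 1) * h k / (real n * (real n - 1)))"
    by (intro expectation_cong_pmf) simp
  then show ?thesis
    using expectation_block_containing[of "{z,y}" h] assms by (simp add: numeral_2_eq_2)
qed

end

section \<open>Pieces of mass and their moments\<close>

text \<open>A list keeps multiplicities: pieces that meet at one site, even with equal weights, stay
  distinct and are never merged.\<close>

definition split_piece :: "nat set \<Rightarrow> nat \<times> real \<Rightarrow> (nat \<times> real) list" where
  "split_piece A p = (if fst p \<in> A
     then map (\<lambda>y. (y, snd p / real (card A))) (sorted_list_of_set A) else [p])"

definition split_pieces :: "nat set \<Rightarrow> (nat \<times> real) list \<Rightarrow> (nat \<times> real) list" where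
  "split_pieces A ps = concat (map (split_piece A) ps)"

primrec pieces :: "nat \<Rightarrow> (nat \<Rightarrow> nat set) \<Rightarrow> nat \<Rightarrow> (nat \<times> real) list" where
  "pieces x0 A 0 = [(x0, 1)]"
| "pieces x0 A (Suc t) = split_pieces (A (Suc t)) (pieces x0 A t)"

definition mass_at :: "(nat \<times> real) list \<Rightarrow> nat \<Rightarrow> real" where
  "mass_at ps x = (\<Sum>p\<leftarrow>ps. if fst p = x then snd p else 0)"

text \<open>Strict positivity makes the logarithm of every weight meaningful.\<close>

definition prob_pieces :: "nat \<Rightarrow> (nat \<times> real) list \<Rightarrow> bool" where
  "prob_pieces n ps \<longleftrightarrow> (\<forall>p\<in>set ps. fst p \<in> {1..n} \<and> snd p > 0) \<and> (\<Sum>p\<leftarrow>ps. snd p) = 1"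

lemma sum_list_split_pieces:
  fixes F :: "nat \<times> real \<Rightarrow> real"
  assumes "finite A"
  shows "(\<Sum>p\<leftarrow>split_pieces A ps. F p) =
    (\<Sum>p\<leftarrow>ps. if fst p \<in> A then (\<Sum>y\<in>A. F (y, snd p / real (card A))) else F p)"
  by (induction ps)
    (auto simp: split_pieces_def split_piece_def o_def sum_list_distinct_conv_sum_set assms)

text \<open>Averaging over a block is linear, so it can be applied to each piece separately before
  the masses at a site are added up.\<close>

lemma mass_at_split_pieces:
  assumes "finite A" "A \<noteq> {}"
  shows "mass_at (split_pieces A ps) = block_avg A (mass_at ps)"
proof
  fix x
  have c: "card A > 0" using assms by (simp add: card_gt_0_iff)
  show "mass_at (split_pieces A ps) x = block_avg A (mass_at ps) x"
  proof (cases "x \<in> A")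
    case True
    have "mass_at (split_pieces A ps) x = (\<Sum>p\<leftarrow>ps. if fst p \<in> A then snd p / real (card A) else 0)"
      unfolding mass_at_def sum_list_split_pieces[OF assms(1)]
      using True assms by (intro arg_cong[where f=sum_list] map_cong) (auto simp: sum.delta')
    also have "\<dots> = (\<Sum>y\<in>A. mass_at ps y) / real (card A)"
      unfolding mass_at_def
      using assms by (induction ps) (auto simp: sum.distrib add_divide_distrib sum.delta)
    finally show ?thesis using True by (simp add: block_avg_def)
  next
    case False
    have "mass_at (split_pieces A ps) x = mass_at ps x"
      unfolding mass_at_def sum_list_split_pieces[OF assms(1)]
      using assms False by (intro arg_cong[where f=sum_list] map_cong refl) (auto simp: sum.delta)
    then show ?thesis using False by (simp add: block_avg_def)
  qed
qed

lemma prob_pieces_split: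
  assumes "prob_pieces n ps" "A \<subseteq> {1..n}" "A \<noteq> {}"
  shows "prob_pieces n (split_pieces A ps)"
proof -
  have fA: "finite A" using assms finite_subset by blast
  then have c: "card A > 0" using assms by (simp add: card_gt_0_iff)
  have "(\<Sum>p\<leftarrow>split_pieces A ps. snd p) = (\<Sum>p\<leftarrow>ps. snd p)"
    unfolding sum_list_split_pieces[OF fA] using c
    by (intro arg_cong[where f=sum_list] map_cong) auto
  then show ?thesis
    using assms c fA by (auto simp: prob_pieces_def split_pieces_def split_piece_def subset_iff split: if_splits)
qed

lemma sum_mass_at_weighted:
  fixes f :: "nat \<Rightarrow> real"
  assumes "\<forall>p\<in>set ps. fst p \<in> {1..n}"
  shows "(\<Sum>x\<in>{1..n}. f x * mass_at ps x) = (\<Sum>p\<leftarrow>ps. f (fst p) * snd p)"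
  using assms unfolding mass_at_def
proof (induction ps)
    case (Cons p ps)
    have "(\<Sum>x\<in>{1..n}. f x * (if fst p = x then snd p else 0)) = f (fst p) * snd p"
      using Cons.prems by (simp add: if_distrib[of "\<lambda>a. _ * a"] cong: if_cong)
    then show ?case using Cons by (simp add: distrib_left sum.distrib)
qed simp

lemma sum_mass_at:
  assumes "\<forall>p\<in>set ps. fst p \<in> {1..n}"
  shows "(\<Sum>x\<in>{1..n}. mass_at ps x) = (\<Sum>p\<leftarrow>ps. snd p)"
  using sum_mass_at_weighted[OF assms, of "\<lambda>_. 1"] by simp

lemma prob_piecesD:
  assumes "prob_pieces n ps"
  shows "\<forall>p\<in>set ps. fst p \<in> {1..n}" "p \<in> set ps \<Longrightarrow> snd p > 0" "(\<Sum>p\<leftarrow>ps. snd p) = 1"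
    "(\<Sum>x\<in>{1..n}. mass_at ps x) = 1"
  using assms sum_mass_at[of ps n] by (auto simp: prob_pieces_def)

lemma block_process_eq_mass_at:
  assumes "\<And>s. 1 \<le> s \<Longrightarrow> s \<le> t \<Longrightarrow> finite (A s) \<and> A s \<noteq> {}"
  shows "block_process (dirac x0) A t = mass_at (pieces x0 A t)"
  using assms
proof (induction t)
  case 0
  show ?case by (auto simp: fun_eq_iff mass_at_def dirac_def indicator_def)
next
  case (Suc t)
  then show ?case by (simp add: mass_at_split_pieces)
qed

section \<open>The Markov chain of pieces and its quadratic moments\<close>

context block_average
begin

text \<open>This law has finite support, so all expectations under it are finite sums. It is tied to
  the infinite product space only in \<open>piece_law_eq_map_Pi_pmf\<close> and
  \<open>integral_d_TV\<close>.\<close>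

primrec piece_law :: "nat \<Rightarrow> nat \<Rightarrow> (nat \<times> real) list pmf" where
  "piece_law x0 0 = return_pmf [(x0, 1)]"
| "piece_law x0 (Suc t) = piece_law x0 t \<bind> (\<lambda>ps. map_pmf (\<lambda>B. split_pieces B ps) (block_law n X))"

lemma finite_piece_law: "finite (set_pmf (piece_law x0 t))"
  by (induction t) (auto simp: finite_block_law)

lemma integrable_piece_law [simp]: "integrable (measure_pmf (piece_law x0 t)) (f :: _ \<Rightarrow> real)"
  by (rule integrable_measure_pmf_finite[OF finite_piece_law])

lemma prob_pieces_piece_law:
  assumes "x0 \<in> {1..n}" "ps \<in> set_pmf (piece_law x0 t)"
  shows "prob_pieces n ps"
  using assms(2)
proof (induction t arbitrary: ps)
  case 0
  then show ?case using assms(1) by (simp add: prob_pieces_def)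
next
  case (Suc t)
  then obtain qs B where "qs \<in> set_pmf (piece_law x0 t)" "B \<in> set_pmf (block_law n X)" "ps = split_pieces B qs"
    by auto
  then show ?case using Suc.IH[of qs] set_block_law[of B] by (auto intro!: prob_pieces_split)
qed

lemma expectation_piece_law_Suc:
  fixes f :: "_ \<Rightarrow> real"
  shows "measure_pmf.expectation (piece_law x0 (Suc t)) f =
    measure_pmf.expectation (piece_law x0 t)
      (\<lambda>ps. measure_pmf.expectation (block_law n X) (\<lambda>B. f (split_pieces B ps)))"
  by (simp add: expectation_bind_finite finite_piece_law finite_block_law)

text \<open>A block of size \<open>k\<close> hits a given piece with probability
  \<open>k / n\<close> and turns \<open>w^2\<close> into \<open>k * (w / k)^2 = w^2 / k\<close>. The
  expected relative loss is therefore the mean of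
  \<open>(k / n) * (1 - 1 / k) = (k - 1) / n\<close>.\<close>

lemma expectation_sum_sq_split:
  assumes "prob_pieces n ps"
  shows "measure_pmf.expectation (block_law n X) (\<lambda>B. \<Sum>p\<leftarrow>split_pieces B ps. (snd p)\<^sup>2)
      = (1 - (mean X - 1) / real n) * (\<Sum>p\<leftarrow>ps. (snd p)\<^sup>2)"
proof -
  have e: "(\<Sum>p\<leftarrow>split_pieces B ps. (snd p)\<^sup>2) =
      (\<Sum>p\<leftarrow>ps. (snd p)\<^sup>2 + (if fst p \<in> B then (snd p)\<^sup>2 * (1 / real (card B) - 1) else 0))"
    if "B \<in> set_pmf (block_law n X)" for B
    unfolding sum_list_split_pieces[OF set_block_law(2)[OF that]] using set_block_law(4)[OF that]
    by (intro arg_cong[where f=sum_list] map_cong) (auto simp: power2_eq_square field_simps)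
  have m: "measure_pmf.expectation X (\<lambda>k. real k * (a * (1 / real k - 1))) = a * (1 - mean X)" for a
  proof -
    have "measure_pmf.expectation X (\<lambda>k. real k * (a * (1 / real k - 1))) =
      measure_pmf.expectation X (\<lambda>k. a * (1 - real k))"
      by (rule expectation_cong_pmf) (use X_range in \<open>auto simp: field_simps\<close>)
    also have "\<dots> = a * (1 - mean X)" by (simp add: mean_def)
    finally show ?thesis .
  qed
  have "measure_pmf.expectation (block_law n X) (\<lambda>B. \<Sum>p\<leftarrow>split_pieces B ps. (snd p)\<^sup>2)
      = (\<Sum>p\<leftarrow>ps. measure_pmf.expectation (block_law n X)
          (\<lambda>B. (snd p)\<^sup>2 + (if fst p \<in> B then (snd p)\<^sup>2 * (1 / real (card B) - 1) else 0)))"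
    by (subst expectation_cong_pmf[OF e]) (auto simp: expectation_sum_list finite_block_law)
  also have "\<dots> = (\<Sum>p\<leftarrow>ps. (1 - (mean X - 1) / real n) * (snd p)\<^sup>2)"
  proof (intro arg_cong[where f=sum_list] map_cong refl)
    fix p assume "p \<in> set ps"
    then have "fst p \<in> {1..n}" using assms by (auto simp: prob_pieces_def)
    from expectation_block_mem[OF this, of "\<lambda>k. (snd p)\<^sup>2 * (1 / real k - 1)", unfolded m]
    show "measure_pmf.expectation (block_law n X)
          (\<lambda>B. (snd p)\<^sup>2 + (if fst p \<in> B then (snd p)\<^sup>2 * (1 / real (card B) - 1) else 0))
        = (1 - (mean X - 1) / real n) * (snd p)\<^sup>2"
      using n2 by (simp add: field_simps)
  qed
  finally show ?thesis by (simp add: sum_list_const_mult)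
qed

lemma expectation_sum_sq_pieces:
  assumes "x0 \<in> {1..n}"
  shows "measure_pmf.expectation (piece_law x0 t) (\<lambda>ps. \<Sum>p\<leftarrow>ps. (snd p)\<^sup>2)
    = (1 - (mean X - 1) / real n) ^ t"
proof (induction t)
  case (Suc t)
  have "measure_pmf.expectation (piece_law x0 (Suc t)) (\<lambda>ps. \<Sum>p\<leftarrow>ps. (snd p)\<^sup>2) =
    measure_pmf.expectation (piece_law x0 t) (\<lambda>ps. (1 - (mean X - 1) / real n) * (\<Sum>p\<leftarrow>ps. (snd p)\<^sup>2))"
    unfolding expectation_piece_law_Suc
    by (intro expectation_cong_pmf expectation_sum_sq_split prob_pieces_piece_law[OF assms])
  then show ?case using Suc by simp
qed simp

text \<open>On the block the new sum of squares is
  \<open>(\<Sum>y\<in>B. \<eta> y)^2 / card B\<close>. It is expanded over all pairs of sites with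
  indicators, so that the random \<open>B\<close> enters only through the inclusion of one or two
  sites.\<close>

lemma sum_sq_block_avg:
  assumes "B \<subseteq> {1..n}"
  shows "(\<Sum>x\<in>{1..n}. (block_avg B \<eta> x)\<^sup>2) = (\<Sum>x\<in>{1..n}. (\<eta> x)\<^sup>2)
    + (\<Sum>x\<in>{1..n}. \<Sum>y\<in>{1..n}. \<eta> x * \<eta> y * (if x \<in> B \<and> y \<in> B then 1 / real (card B) else 0))
    - (\<Sum>x\<in>{1..n}. (\<eta> x)\<^sup>2 * (if x \<in> B then 1 else 0))"
proof -
  let ?s = "\<Sum>y\<in>B. \<eta> y"
  have fB: "finite B" using assms finite_subset by blast
  have 1: "(\<Sum>x\<in>{1..n}. (if x \<in> B then f x else 0)) = (\<Sum>x\<in>B. f x)" for f :: "nat \<Rightarrow> real"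
    using assms by (subst sum.inter_restrict[symmetric]) (auto simp: Int_absorb1)
  have "(\<Sum>x\<in>{1..n}. (block_avg B \<eta> x)\<^sup>2) =
     (\<Sum>x\<in>{1..n}. (if x \<in> B then (?s / real (card B))\<^sup>2 else 0) + ((\<eta> x)\<^sup>2 - (if x \<in> B then (\<eta> x)\<^sup>2 else 0)))"
    by (intro sum.cong) (auto simp: block_avg_def)
  also have "\<dots> = (\<Sum>x\<in>B. (?s / real (card B))\<^sup>2) + ((\<Sum>x\<in>{1..n}. (\<eta> x)\<^sup>2) - (\<Sum>x\<in>B. (\<eta> x)\<^sup>2))"
    by (simp only: sum.distrib sum_subtractf 1)
  also have "(\<Sum>x\<in>B. (?s / real (card B))\<^sup>2) = ?s * ?s / real (card B)"
    by (simp add: power2_eq_square)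
  also have "?s * ?s / real (card B) = (\<Sum>x\<in>B. \<Sum>y\<in>B. \<eta> x * \<eta> y / real (card B))"
    by (simp add: sum_product sum_divide_distrib)
  also have "\<dots> = (\<Sum>x\<in>{1..n}. if x \<in> B then \<Sum>y\<in>{1..n}. if y \<in> B then \<eta> x * \<eta> y / real (card B) else 0 else 0)"
    by (simp only: 1)
  also have "\<dots> = (\<Sum>x\<in>{1..n}. \<Sum>y\<in>{1..n}. \<eta> x * \<eta> y * (if x \<in> B \<and> y \<in> B then 1 / real (card B) else 0))"
    by (intro sum.cong refl) (auto intro!: sum.cong sum.neutral)
  also have "(\<Sum>x\<in>B. (\<eta> x)\<^sup>2) = (\<Sum>x\<in>{1..n}. (\<eta> x)\<^sup>2 * (if x \<in> B then 1 else 0))"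
    unfolding 1[symmetric] by (intro sum.cong) auto
  finally show ?thesis by simp
qed

text \<open>The coefficient of \<open>\<eta> x * \<eta> y\<close> has mean \<open>1 / n\<close> on
  the diagonal and a constant mean \<open>b\<close> off it. As the total mass is one, the
  off-diagonal products sum to one minus the sum of squares, which closes the recursion.\<close>

lemma expectation_sum_sq_block_avg:
  assumes "(\<Sum>x\<in>{1..n}. \<eta> x) = 1"
  shows "measure_pmf.expectation (block_law n X) (\<lambda>B. \<Sum>x\<in>{1..n}. (block_avg B \<eta> x)\<^sup>2)
    = (1 - (mean X - 1) / (real n - 1)) * (\<Sum>x\<in>{1..n}. (\<eta> x)\<^sup>2) + (mean X - 1) / (real n * (real n - 1))"
proof -
  let ?E = "measure_pmf.expectation (block_law n X)"
  let ?S = "\<Sum>x\<in>{1..n}. (\<eta> x)\<^sup>2"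
  define b where "b = (mean X - 1) / (real n * (real n - 1))"
  have n1: "real n - 1 > 0" using n2 by simp
  have d: "?E (\<lambda>B. if x \<in> B \<and> x \<in> B then 1 / real (card B) else 0) = 1 / real n" if "x \<in> {1..n}" for x
  proof -
    have "measure_pmf.expectation X (\<lambda>k. real k * (1 / real k)) = measure_pmf.expectation X (\<lambda>k. 1)"
      by (rule expectation_cong_pmf) (use X_range in auto)
    then show ?thesis using expectation_block_mem[OF that, of "\<lambda>k. 1 / real k"] by simp
  qed
  have o: "?E (\<lambda>B. if x \<in> B \<and> y \<in> B then 1 / real (card B) else 0) = b"
    if "x \<in> {1..n}" "y \<in> {1..n}" "x \<noteq> y" for x y
  proof -
    have "measure_pmf.expectation X (\<lambda>k. real k * (real k - 1) * (1 / real k)) = measure_pmf.expectation X (\<lambda>k. real k - 1)"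
      by (rule expectation_cong_pmf) (use X_range in auto)
    then show ?thesis unfolding expectation_block_mem2[OF that, of "\<lambda>k. 1 / real k"]
      by (simp add: b_def mean_def)
  qed
  have m: "?E (\<lambda>B. if x \<in> B then 1 else 0) = mean X / real n" if "x \<in> {1..n}" for x
    using expectation_block_mem[OF that, of "\<lambda>_. 1"] by (simp add: mean_def)
  have "?E (\<lambda>B. \<Sum>x\<in>{1..n}. (block_avg B \<eta> x)\<^sup>2) = ?E (\<lambda>B. ?S
    + (\<Sum>x\<in>{1..n}. \<Sum>y\<in>{1..n}. \<eta> x * \<eta> y * (if x \<in> B \<and> y \<in> B then 1 / real (card B) else 0))
    - (\<Sum>x\<in>{1..n}. (\<eta> x)\<^sup>2 * (if x \<in> B then 1 else 0)))"
    by (intro expectation_cong_pmf sum_sq_block_avg set_block_law)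
  also have "\<dots> = ?S + (\<Sum>x\<in>{1..n}. \<Sum>y\<in>{1..n}. \<eta> x * \<eta> y * ?E (\<lambda>B. if x \<in> B \<and> y \<in> B then 1 / real (card B) else 0))
    - (\<Sum>x\<in>{1..n}. (\<eta> x)\<^sup>2 * ?E (\<lambda>B. if x \<in> B then 1 else 0))"
    by (simp add: Bochner_Integration.integral_sum del: mult_if_delta)
  also have "(\<Sum>x\<in>{1..n}. (\<eta> x)\<^sup>2 * ?E (\<lambda>B. if x \<in> B then 1 else 0)) = mean X / real n * ?S"
    by (simp add: m sum_distrib_left mult.commute)
  also have "(\<Sum>x\<in>{1..n}. \<Sum>y\<in>{1..n}. \<eta> x * \<eta> y * ?E (\<lambda>B. if x \<in> B \<and> y \<in> B then 1 / real (card B) else 0))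
    = (\<Sum>x\<in>{1..n}. \<Sum>y\<in>{1..n}. b * (\<eta> x * \<eta> y) + (if x = y then (1 / real n - b) * (\<eta> x)\<^sup>2 else 0))"
    by (intro sum.cong refl, case_tac "x = xa") (use d o in \<open>auto simp: power2_eq_square algebra_simps\<close>)
  also have "\<dots> = b * ((\<Sum>x\<in>{1..n}. \<eta> x) * (\<Sum>x\<in>{1..n}. \<eta> x)) + (1 / real n - b) * ?S"
  proof -
    have 1: "(\<Sum>x\<in>{1..n}. \<Sum>y\<in>{1..n}. b * (\<eta> x * \<eta> y)) = b * ((\<Sum>x\<in>{1..n}. \<eta> x) * (\<Sum>x\<in>{1..n}. \<eta> x))"
      unfolding sum_product by (simp only: sum_distrib_left)
    have 2: "(\<Sum>x\<in>{1..n}. \<Sum>y\<in>{1..n}. if x = y then (1 / real n - b) * (\<eta> x)\<^sup>2 else 0) = (1 / real n - b) * ?S"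
      by (simp add: sum_distrib_left)
    show ?thesis unfolding sum.distrib 1 2 ..
  qed
  also have "?S + (b * ((\<Sum>x\<in>{1..n}. \<eta> x) * (\<Sum>x\<in>{1..n}. \<eta> x)) + (1 / real n - b) * ?S) - mean X / real n * ?S
     = (1 + 1 / real n - b - mean X / real n) * ?S + b"
    unfolding assms by (simp add: algebra_simps)
  also have "1 + 1 / real n - b - mean X / real n = 1 - (mean X - 1) / (real n - 1)"
    unfolding b_def using n1 n2 by (simp add: field_simps)
  finally show ?thesis by (simp add: b_def)
qed

text \<open>The value \<open>1 / n\<close> is the fixed point of the affine one-step recursion; the
  excess over it starts at \<open>1 - 1 / n\<close> and shrinks by a constant factor.\<close>

lemma expectation_sum_sq_mass_at:
  assumes "x0 \<in> {1..n}"
  shows "measure_pmf.expectation (piece_law x0 t) (\<lambda>ps. \<Sum>x\<in>{1..n}. (mass_at ps x)\<^sup>2)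
    = 1 / real n + (1 - 1 / real n) * (1 - (mean X - 1) / (real n - 1)) ^ t"
proof (induction t)
  case 0
  show ?case using assms by (simp add: mass_at_def if_distrib[of "\<lambda>a. a\<^sup>2"] cong: if_cong)
next
  case (Suc t)
  let ?r = "1 - (mean X - 1) / (real n - 1)"
  have "measure_pmf.expectation (piece_law x0 (Suc t)) (\<lambda>ps. \<Sum>x\<in>{1..n}. (mass_at ps x)\<^sup>2) =
    measure_pmf.expectation (piece_law x0 t)
      (\<lambda>ps. ?r * (\<Sum>x\<in>{1..n}. (mass_at ps x)\<^sup>2) + (mean X - 1) / (real n * (real n - 1)))"
    unfolding expectation_piece_law_Suc
  proof (rule expectation_cong_pmf)
    fix ps assume "ps \<in> set_pmf (piece_law x0 t)"
    then have ps: "prob_pieces n ps" by (rule prob_pieces_piece_law[OF assms])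
    have "measure_pmf.expectation (block_law n X) (\<lambda>B. \<Sum>x\<in>{1..n}. (mass_at (split_pieces B ps) x)\<^sup>2)
       = measure_pmf.expectation (block_law n X) (\<lambda>B. \<Sum>x\<in>{1..n}. (block_avg B (mass_at ps) x)\<^sup>2)"
    proof (rule expectation_cong_pmf)
      fix B assume "B \<in> set_pmf (block_law n X)"
      from set_block_law[OF this] show "(\<Sum>x\<in>{1..n}. (mass_at (split_pieces B ps) x)\<^sup>2) =
          (\<Sum>x\<in>{1..n}. (block_avg B (mass_at ps) x)\<^sup>2)"
        by (subst mass_at_split_pieces) auto
    qed
    then show "measure_pmf.expectation (block_law n X) (\<lambda>B. \<Sum>x\<in>{1..n}. (mass_at (split_pieces B ps) x)\<^sup>2)
       = ?r * (\<Sum>x\<in>{1..n}. (mass_at ps x)\<^sup>2) + (mean X - 1) / (real n * (real n - 1))"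
      by (simp only: expectation_sum_sq_block_avg[OF prob_piecesD(4)[OF ps]])
  qed
  also have "\<dots> = ?r * (1 / real n + (1 - 1 / real n) * ?r ^ t) + (mean X - 1) / (real n * (real n - 1))"
    unfolding Suc[symmetric] by (rule expectation_affine[OF finite_piece_law])
  also have "(mean X - 1) / (real n * (real n - 1)) = (1 - ?r) / real n" by simp
  also have "r * (1 / real n + (1 - 1 / real n) * r ^ t) + (1 - r) / real n =
      1 / real n + (1 - 1 / real n) * r ^ Suc t" for r
    by (simp add: algebra_simps diff_divide_distrib)
  finally show ?case .
qed

lemma mean_bounds: "2 \<le> mean X" "mean X \<le> real n"
proof -
  have "measure_pmf.expectation X (\<lambda>_. 2) \<le> measure_pmf.expectation X real"
    using X_range by (intro expectation_mono_finite finite_X) auto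
  then show "2 \<le> mean X" by (simp add: mean_def)
  have "measure_pmf.expectation X real \<le> measure_pmf.expectation X (\<lambda>_. real n)"
    using X_range by (intro expectation_mono_finite finite_X) auto
  then show "mean X \<le> real n" by (simp add: mean_def)
qed

text \<open>The site recursion contracts at least as fast as the piece recursion, because
  \<open>n - 1 < n\<close> in the denominators. The decaying terms thus have a nonpositive
  difference, and only the fixed point \<open>1 / n\<close> remains. That
  \<open>mean X \<le> n\<close> keeps the smaller factor nonnegative, so that powers preserve the
  comparison.\<close>

lemma expectation_collisions:
  assumes "x0 \<in> {1..n}"
  shows "measure_pmf.expectation (piece_law x0 t)
    (\<lambda>ps. (\<Sum>x\<in>{1..n}. (mass_at ps x)\<^sup>2) - (\<Sum>p\<leftarrow>ps. (snd p)\<^sup>2)) \<le> 1 / real n"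
proof -
  let ?r = "1 - (mean X - 1) / (real n - 1)" and ?s = "1 - (mean X - 1) / real n"
  have r: "0 \<le> ?r" using mean_bounds n2 by (simp add: field_simps)
  have "?r \<le> ?s" using mean_bounds n2 by (simp add: frac_le)
  then have "?r ^ t \<le> ?s ^ t" using r by (rule power_mono)
  moreover have "(1 - 1 / real n) * ?r ^ t \<le> 1 * ?r ^ t"
    using r by (intro mult_right_mono) auto
  ultimately have "(1 - 1 / real n) * ?r ^ t \<le> ?s ^ t" by simp
  moreover have "measure_pmf.expectation (piece_law x0 t)
      (\<lambda>ps. (\<Sum>x\<in>{1..n}. (mass_at ps x)\<^sup>2) - (\<Sum>p\<leftarrow>ps. (snd p)\<^sup>2))
    = (1 / real n + (1 - 1 / real n) * ?r ^ t) - ?s ^ t"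
    unfolding expectation_sum_sq_mass_at[OF assms, symmetric] expectation_sum_sq_pieces[OF assms, symmetric]
    by (rule Bochner_Integration.integral_diff; rule integrable_piece_law)
  ultimately show ?thesis by simp
qed

section \<open>Drift and fluctuation of the logarithmic weights\<close>

definition "log_rate = measure_pmf.expectation X (\<lambda>k. real k * ln (real k)) / real n"
definition "log_sq_rate = measure_pmf.expectation X (\<lambda>k. real k * (ln (real k))\<^sup>2) / real n"

text \<open>A piece is hit by a block of size \<open>k\<close> with probability
  \<open>k / n\<close>, and then \<open>- ln w\<close> grows by \<open>ln k\<close>; so
  \<open>log_rate\<close> and \<open>log_sq_rate\<close> are the first two moments of one increment.
  Shifting the centre by \<open>log_rate\<close> removes the cross term, and only the variance of
  the increment is added.\<close>

lemma expectation_log_weight_split: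
  assumes "prob_pieces n ps"
  shows "measure_pmf.expectation (block_law n X)
      (\<lambda>B. \<Sum>p\<leftarrow>split_pieces B ps. snd p * (- ln (snd p) - (s + log_rate))\<^sup>2)
    \<le> (\<Sum>p\<leftarrow>ps. snd p * (- ln (snd p) - s)\<^sup>2) + log_sq_rate"
proof -
  let ?D = "\<lambda>p::nat\<times>real. - ln (snd p) - s - log_rate"
  have pos: "snd p > 0" "fst p \<in> {1..n}" if "p \<in> set ps" for p
    using assms that by (auto simp: prob_pieces_def)
  have e: "(\<Sum>p\<leftarrow>split_pieces B ps. snd p * (- ln (snd p) - (s + log_rate))\<^sup>2) =
      (\<Sum>p\<leftarrow>ps. snd p * (?D p)\<^sup>2 + snd p * (if fst p \<in> B then 2 * ?D p * ln (card B) + (ln (card B))\<^sup>2 else 0))"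
    if "B \<in> set_pmf (block_law n X)" for B
    unfolding sum_list_split_pieces[OF set_block_law(2)[OF that]]
  proof (intro arg_cong[where f=sum_list] map_cong refl)
    fix p assume p: "p \<in> set ps"
    have c: "real (card B) > 0" using set_block_law(4)[OF that] by simp
    have d: "- ln (snd p) - (s + log_rate) = ?D p" by simp
    \<comment> \<open>The \<open>card B\<close> new pieces together keep the weight
      \<open>w\<close>, and each has its \<open>- ln\<close> raised by
      \<open>ln (card B)\<close>.\<close>
    have "(\<Sum>y\<in>B. snd (y, snd p / real (card B)) * (- ln (snd (y, snd p / real (card B))) - (s + log_rate))\<^sup>2)
        = snd p * (?D p + ln (card B))\<^sup>2"
      using c pos[OF p] by (simp add: ln_div algebra_simps)
    also have "\<dots> = snd p * (?D p)\<^sup>2 + snd p * (2 * ?D p * ln (card B) + (ln (card B))\<^sup>2)"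
      unfolding power2_sum distrib_left by (simp only: ac_simps)
    finally show "(if fst p \<in> B then \<Sum>y\<in>B. snd (y, snd p / real (card B)) * (- ln (snd (y, snd p / real (card B))) - (s + log_rate))\<^sup>2
         else snd p * (- ln (snd p) - (s + log_rate))\<^sup>2) =
       snd p * (?D p)\<^sup>2 + snd p * (if fst p \<in> B then 2 * ?D p * ln (card B) + (ln (card B))\<^sup>2 else 0)"
      unfolding d by simp
  qed
  have "measure_pmf.expectation (block_law n X)
      (\<lambda>B. \<Sum>p\<leftarrow>split_pieces B ps. snd p * (- ln (snd p) - (s + log_rate))\<^sup>2)
    = (\<Sum>p\<leftarrow>ps. measure_pmf.expectation (block_law n X)
          (\<lambda>B. snd p * (?D p)\<^sup>2 + snd p * (if fst p \<in> B then 2 * ?D p * ln (card B) + (ln (card B))\<^sup>2 else 0)))"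
    by (subst expectation_cong_pmf[OF e]) (auto simp: expectation_sum_list finite_block_law)
  also have "\<dots> = (\<Sum>p\<leftarrow>ps. snd p * (?D p)\<^sup>2 + snd p * (2 * ?D p * log_rate + log_sq_rate))"
  proof (intro arg_cong[where f=sum_list] map_cong refl)
    fix p assume p: "p \<in> set ps"
    have "measure_pmf.expectation X (\<lambda>k. real k * (2 * ?D p * ln k + (ln k)\<^sup>2)) =
       measure_pmf.expectation X (\<lambda>k. 2 * ?D p * (real k * ln k) + real k * (ln k)\<^sup>2)"
      by (simp add: algebra_simps)
    also have "\<dots> = 2 * ?D p * measure_pmf.expectation X (\<lambda>k. real k * ln k)
        + measure_pmf.expectation X (\<lambda>k. real k * (ln k)\<^sup>2)"
      by (subst Bochner_Integration.integral_add) auto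
    finally have "measure_pmf.expectation X (\<lambda>k. real k * (2 * ?D p * ln k + (ln k)\<^sup>2)) / real n
        = 2 * ?D p * log_rate + log_sq_rate"
      by (simp add: log_rate_def log_sq_rate_def add_divide_distrib)
    with expectation_block_mem[OF pos(2)[OF p], of "\<lambda>k. 2 * ?D p * ln k + (ln k)\<^sup>2"]
    show "measure_pmf.expectation (block_law n X)
          (\<lambda>B. snd p * (?D p)\<^sup>2 + snd p * (if fst p \<in> B then 2 * ?D p * ln (card B) + (ln (card B))\<^sup>2 else 0))
      = snd p * (?D p)\<^sup>2 + snd p * (2 * ?D p * log_rate + log_sq_rate)"
      by (subst Bochner_Integration.integral_add) auto
  qed
  also have "\<dots> \<le> (\<Sum>p\<leftarrow>ps. snd p * (- ln (snd p) - s)\<^sup>2 + snd p * log_sq_rate)"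
  proof (rule sum_list_mono)
    fix p assume p: "p \<in> set ps"
    \<comment> \<open>Completing the square moves the centre back to \<open>s\<close>; the term
      \<open>- log_rate^2\<close> is then dropped.\<close>
    have "(?D p)\<^sup>2 + (2 * ?D p * log_rate + log_sq_rate) = (- ln (snd p) - s)\<^sup>2 + log_sq_rate - log_rate\<^sup>2"
      by (simp add: power2_eq_square algebra_simps)
    also have "\<dots> \<le> (- ln (snd p) - s)\<^sup>2 + log_sq_rate" by simp
    finally have "snd p * ((?D p)\<^sup>2 + (2 * ?D p * log_rate + log_sq_rate)) \<le> snd p * ((- ln (snd p) - s)\<^sup>2 + log_sq_rate)"
      using pos[OF p] by (intro mult_left_mono) auto
    then show "snd p * (?D p)\<^sup>2 + snd p * (2 * ?D p * log_rate + log_sq_rate)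
      \<le> snd p * (- ln (snd p) - s)\<^sup>2 + snd p * log_sq_rate" by (simp only: distrib_left)
  qed
  also have "\<dots> = (\<Sum>p\<leftarrow>ps. snd p * (- ln (snd p) - s)\<^sup>2) + log_sq_rate"
    using assms by (simp add: sum_list_addf sum_list_mult_const prob_pieces_def)
  finally show ?thesis .
qed

lemma log_weight_variance:
  assumes "x0 \<in> {1..n}"
  shows "measure_pmf.expectation (piece_law x0 t)
      (\<lambda>ps. \<Sum>p\<leftarrow>ps. snd p * (- ln (snd p) - real t * log_rate)\<^sup>2) \<le> real t * log_sq_rate"
proof (induction t)
  case (Suc t)
  have "measure_pmf.expectation (piece_law x0 (Suc t))
      (\<lambda>ps. \<Sum>p\<leftarrow>ps. snd p * (- ln (snd p) - real (Suc t) * log_rate)\<^sup>2)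
    \<le> measure_pmf.expectation (piece_law x0 t)
      (\<lambda>ps. (\<Sum>p\<leftarrow>ps. snd p * (- ln (snd p) - real t * log_rate)\<^sup>2) + log_sq_rate)"
    unfolding expectation_piece_law_Suc
  proof (rule expectation_mono_finite[OF finite_piece_law])
    fix ps assume "ps \<in> set_pmf (piece_law x0 t)"
    from expectation_log_weight_split[OF prob_pieces_piece_law[OF assms this], of "real t * log_rate"]
    show "measure_pmf.expectation (block_law n X)
      (\<lambda>B. \<Sum>p\<leftarrow>split_pieces B ps. snd p * (- ln (snd p) - real (Suc t) * log_rate)\<^sup>2)
      \<le> (\<Sum>p\<leftarrow>ps. snd p * (- ln (snd p) - real t * log_rate)\<^sup>2) + log_sq_rate"
      by (simp add: algebra_simps)
  qed
  then show ?case using Suc by (simp add: algebra_simps)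
qed simp

end

section \<open>Total variation and the weights of the pieces\<close>

lemma mass_at_nonneg: "(\<And>p. p \<in> set ps \<Longrightarrow> snd p \<ge> 0) \<Longrightarrow> mass_at ps x \<ge> 0"
  unfolding mass_at_def by (rule sum_list_nonneg) auto

lemma mass_at_filter_nonneg: "prob_pieces n ps \<Longrightarrow> mass_at (filter P ps) x \<ge> 0"
  by (rule mass_at_nonneg) (auto dest: prob_piecesD(2) intro: less_imp_le)

lemma mass_at_filter_split:
  "mass_at ps x = mass_at (filter P ps) x + mass_at (filter (\<lambda>p. \<not> P p) ps) x"
  by (induction ps) (auto simp: mass_at_def)

lemma sum_list_filter_split:
  fixes f :: "'a \<Rightarrow> real"
  shows "(\<Sum>p\<leftarrow>ps. f p) = (\<Sum>p\<leftarrow>filter P ps. f p) + (\<Sum>p\<leftarrow>filter (\<lambda>p. \<not> P p) ps. f p)"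
  by (induction ps) auto

text \<open>Squaring the mass at a site produces the squares of its pieces and nonnegative cross
  terms.\<close>

lemma sum_sq_le_sum_sq_mass_at:
  assumes "\<And>p. p \<in> set ps \<Longrightarrow> fst p \<in> {1..n} \<and> snd p \<ge> 0"
  shows "(\<Sum>p\<leftarrow>ps. (snd p)\<^sup>2) \<le> (\<Sum>x\<in>{1..n}. (mass_at ps x)\<^sup>2)"
  using assms
proof (induction ps)
  case (Cons p ps)
  have m: "mass_at (p # ps) x = (if fst p = x then snd p else 0) + mass_at ps x" for x
    by (simp add: mass_at_def)
  have "(snd p)\<^sup>2 + (\<Sum>x\<in>{1..n}. (mass_at ps x)\<^sup>2)
    = (\<Sum>x\<in>{1..n}. (if fst p = x then (snd p)\<^sup>2 else 0) + (mass_at ps x)\<^sup>2)"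
    using Cons.prems[of p] by (simp add: sum.distrib)
  also have "\<dots> \<le> (\<Sum>x\<in>{1..n}. (mass_at (p # ps) x)\<^sup>2)"
  proof (rule sum_mono)
    fix x
    have "mass_at ps x \<ge> 0" "snd p \<ge> 0" using Cons.prems by (auto intro!: mass_at_nonneg)
    then show "(if fst p = x then (snd p)\<^sup>2 else 0) + (mass_at ps x)\<^sup>2 \<le> (mass_at (p # ps) x)\<^sup>2"
      unfolding m by (auto simp: power2_sum)
  qed
  finally show ?case using Cons by simp
qed (simp add: sum_nonneg)

definition heavy_mass :: "real \<Rightarrow> (nat \<times> real) list \<Rightarrow> real" where
  "heavy_mass \<theta> ps = (\<Sum>p\<leftarrow>filter (\<lambda>p. snd p > \<theta>) ps. snd p)"

text \<open>Superadditivity of squares bounds the light part by the full square norm minus the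
  squares of the heavy pieces. Hence the light part has no more collisions than the whole, and its
  own pieces contribute at most \<open>\<theta>\<close> times their total weight.\<close>

lemma sum_sq_light_le:
  assumes "prob_pieces n ps"
  shows "(\<Sum>x\<in>{1..n}. (mass_at (filter (\<lambda>p. \<not> snd p > \<theta>) ps) x)\<^sup>2)
    \<le> max \<theta> 0 + ((\<Sum>x\<in>{1..n}. (mass_at ps x)\<^sup>2) - (\<Sum>p\<leftarrow>ps. (snd p)\<^sup>2))"
proof -
  let ?H = "filter (\<lambda>p. snd p > \<theta>) ps" and ?L = "filter (\<lambda>p. \<not> snd p > \<theta>) ps"
  have pos: "fst p \<in> {1..n}" "snd p \<ge> 0" if "p \<in> set ps" for p
    using prob_piecesD(1)[OF assms] prob_piecesD(2)[OF assms that] that by auto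
  have "(\<Sum>p\<leftarrow>?L. (snd p)\<^sup>2) \<le> (\<Sum>p\<leftarrow>?L. max \<theta> 0 * snd p)"
    by (rule sum_list_mono) (auto simp: power2_eq_square intro!: mult_right_mono dest: pos)
  also have "\<dots> = max \<theta> 0 * (\<Sum>p\<leftarrow>?L. snd p)" by (simp add: sum_list_const_mult)
  also have "\<dots> \<le> max \<theta> 0 * 1"
  proof (rule mult_left_mono)
    have "(\<Sum>p\<leftarrow>?H. snd p) \<ge> 0" by (rule sum_list_nonneg) (auto dest: pos)
    then show "(\<Sum>p\<leftarrow>?L. snd p) \<le> 1"
      using sum_list_filter_split[of snd ps "\<lambda>p. snd p > \<theta>"] prob_piecesD(3)[OF assms] by simp
  qed simp
  finally have L: "(\<Sum>p\<leftarrow>?L. (snd p)\<^sup>2) \<le> max \<theta> 0" by simp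
  have "(\<Sum>x\<in>{1..n}. (mass_at ?L x)\<^sup>2) + (\<Sum>p\<leftarrow>?H. (snd p)\<^sup>2)
      \<le> (\<Sum>x\<in>{1..n}. (mass_at ?L x)\<^sup>2) + (\<Sum>x\<in>{1..n}. (mass_at ?H x)\<^sup>2)"
    using pos by (intro add_left_mono sum_sq_le_sum_sq_mass_at) auto
  also have "\<dots> = (\<Sum>x\<in>{1..n}. (mass_at ?L x)\<^sup>2 + (mass_at ?H x)\<^sup>2)" by (simp add: sum.distrib)
  also have "\<dots> \<le> (\<Sum>x\<in>{1..n}. (mass_at ps x)\<^sup>2)"
  proof (rule sum_mono)
    fix x
    have "mass_at ?L x \<ge> 0" "mass_at ?H x \<ge> 0" by (simp_all add: mass_at_filter_nonneg[OF assms])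
    then show "(mass_at ?L x)\<^sup>2 + (mass_at ?H x)\<^sup>2 \<le> (mass_at ps x)\<^sup>2"
      unfolding mass_at_filter_split[of ps x "\<lambda>p. snd p > \<theta>"] by (simp add: power2_sum)
  qed
  finally show ?thesis
    using L sum_list_filter_split[of "\<lambda>p. (snd p)\<^sup>2" ps "\<lambda>p. snd p > \<theta>"] by simp
qed

text \<open>Heavy pieces cost at most their mass, and the light part is compared with the uniform
  vector in square norm. The inequality of arithmetic and geometric means with a free parameter
  \<open>\<alpha>\<close> takes the place of Cauchy-Schwarz: the bound is then affine in the random
  quantities, and expectations can be taken term by term.\<close>

lemma tv_norm_le:
  assumes "prob_pieces n ps" "n \<ge> 1" "\<alpha> > 0" "\<theta> \<ge> 0"
  shows "tv_norm n (\<lambda>x. mass_at ps x - 1 / real n) \<le> (heavy_mass \<theta> ps + \<alpha> / 2 + (real n * \<theta>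
     + real n * ((\<Sum>x\<in>{1..n}. (mass_at ps x)\<^sup>2) - (\<Sum>p\<leftarrow>ps. (snd p)\<^sup>2)) + 2 * heavy_mass \<theta> ps - 1) / (2 * \<alpha>)) / 2"
proof -
  let ?H = "filter (\<lambda>p. snd p > \<theta>) ps" and ?L = "filter (\<lambda>p. \<not> snd p > \<theta>) ps"
  let ?Q = "(\<Sum>x\<in>{1..n}. (mass_at ps x)\<^sup>2) - (\<Sum>p\<leftarrow>ps. (snd p)\<^sup>2)"
  have pos: "fst p \<in> {1..n}" "snd p \<ge> 0" if "p \<in> set ps" for p
    using prob_piecesD(1)[OF assms(1)] prob_piecesD(2)[OF assms(1) that] that by auto
  have n: "real n > 0" using assms by simp
  have sH: "(\<Sum>x\<in>{1..n}. mass_at ?H x) = heavy_mass \<theta> ps"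
    unfolding heavy_mass_def using pos by (intro sum_mass_at) auto
  have sL: "(\<Sum>x\<in>{1..n}. mass_at ?L x) = 1 - heavy_mass \<theta> ps"
  proof -
    have "(\<Sum>x\<in>{1..n}. mass_at ?L x) = (\<Sum>p\<leftarrow>?L. snd p)" using pos by (intro sum_mass_at) auto
    then show ?thesis
      using sum_list_filter_split[of snd ps "\<lambda>p. snd p > \<theta>"] prob_piecesD(3)[OF assms(1)]
      unfolding heavy_mass_def by linarith
  qed
  have am: "\<bar>v\<bar> \<le> \<alpha> / (2 * real n) + real n * v\<^sup>2 / (2 * \<alpha>)" for v :: real
  proof -
    have "0 \<le> (\<alpha> - real n * \<bar>v\<bar>)\<^sup>2" by simp
    then have "2 * \<alpha> * real n * \<bar>v\<bar> \<le> \<alpha>\<^sup>2 + (real n)\<^sup>2 * v\<^sup>2"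
      by (simp add: power2_diff power_mult_distrib)
    then show ?thesis using n assms(3) by (simp add: field_simps power2_eq_square)
  qed
  have "(\<Sum>x\<in>{1..n}. \<bar>mass_at ps x - 1 / real n\<bar>)
    \<le> (\<Sum>x\<in>{1..n}. mass_at ?H x + (\<alpha> / (2 * real n) + real n * (mass_at ?L x - 1 / real n)\<^sup>2 / (2 * \<alpha>)))"
  proof (rule sum_mono)
    fix x
    have "mass_at ?H x \<ge> 0" by (simp_all add: mass_at_filter_nonneg[OF assms(1)])
    then have "\<bar>mass_at ps x - 1 / real n\<bar> \<le> mass_at ?H x + \<bar>mass_at ?L x - 1 / real n\<bar>"
      unfolding mass_at_filter_split[of ps x "\<lambda>p. snd p > \<theta>"] by linarith
    with am[of "mass_at ?L x - 1 / real n"]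
    show "\<bar>mass_at ps x - 1 / real n\<bar>
      \<le> mass_at ?H x + (\<alpha> / (2 * real n) + real n * (mass_at ?L x - 1 / real n)\<^sup>2 / (2 * \<alpha>))" by linarith
  qed
  also have "\<dots> = heavy_mass \<theta> ps + (\<alpha> / 2 + real n * (\<Sum>x\<in>{1..n}. (mass_at ?L x - 1 / real n)\<^sup>2) / (2 * \<alpha>))"
    using n by (simp add: sum.distrib sH[symmetric] sum_distrib_left sum_divide_distrib)
  also have "(\<Sum>x\<in>{1..n}. (mass_at ?L x - 1 / real n)\<^sup>2)
      = (\<Sum>x\<in>{1..n}. (mass_at ?L x)\<^sup>2 - 2 / real n * mass_at ?L x + 1 / (real n)\<^sup>2)"
    by (intro sum.cong) (auto simp: power2_diff power_divide)
  also have "\<dots> = (\<Sum>x\<in>{1..n}. (mass_at ?L x)\<^sup>2) - 2 / real n * (1 - heavy_mass \<theta> ps) + 1 / real n"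
    using n by (simp add: sum.distrib sum_subtractf sL[symmetric] sum_distrib_left power2_eq_square)
  \<comment> \<open>The \<open>- 1\<close> comes from \<open>- 2 + 1\<close> when the square is
    expanded with light mass \<open>1 - heavy_mass \<theta> ps\<close>.\<close>
  also have "real n * \<dots> = real n * (\<Sum>x\<in>{1..n}. (mass_at ?L x)\<^sup>2) + 2 * heavy_mass \<theta> ps - 1"
    using n by (simp add: field_simps)
  also have "heavy_mass \<theta> ps + (\<alpha> / 2 + (real n * (\<Sum>x\<in>{1..n}. (mass_at ?L x)\<^sup>2) + 2 * heavy_mass \<theta> ps - 1) / (2 * \<alpha>))
     \<le> heavy_mass \<theta> ps + (\<alpha> / 2 + (real n * (\<theta> + ?Q) + 2 * heavy_mass \<theta> ps - 1) / (2 * \<alpha>))"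
    using n assms(3,4) sum_sq_light_le[OF assms(1), of \<theta>]
    by (intro add_left_mono divide_right_mono diff_right_mono add_right_mono mult_left_mono) auto
  finally show ?thesis by (simp add: tv_norm_def algebra_simps)
qed

text \<open>Pieces heavier than \<open>\<theta>\<close> occupy at most \<open>1 / \<theta>\<close> sites, which carry little uniform mass.\<close>

lemma tv_norm_ge:
  assumes "prob_pieces n ps" "n \<ge> 1" "\<theta> > 0"
  shows "heavy_mass \<theta> ps - 1 / (\<theta> * real n) \<le> tv_norm n (\<lambda>x. mass_at ps x - 1 / real n)"
proof -
  let ?H = "filter (\<lambda>p. snd p > \<theta>) ps"
  define S where "S = fst ` set ?H"
  have pos: "fst p \<in> {1..n}" "snd p \<ge> 0" if "p \<in> set ps" for p
    using prob_piecesD(1)[OF assms(1)] prob_piecesD(2)[OF assms(1) that] that by auto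
  have S: "S \<subseteq> {1..n}" "finite S" unfolding S_def using pos by auto
  have n: "real n > 0" using assms by simp
  have "card S \<le> card (set ?H)" unfolding S_def by (rule card_image_le) simp
  also have "\<dots> \<le> length ?H" by (rule card_length)
  finally have 1: "real (card S) \<le> real (length ?H)" by simp
  have "\<theta> * real (length ?H) = (\<Sum>p\<leftarrow>?H. \<theta>)" by (simp add: sum_list_triv)
  also have "\<dots> \<le> (\<Sum>p\<leftarrow>?H. snd p)" by (rule sum_list_mono) auto
  also have "\<dots> \<le> 1"
  proof -
    have "(\<Sum>p\<leftarrow>filter (\<lambda>p. \<not> snd p > \<theta>) ps. snd p) \<ge> 0" by (rule sum_list_nonneg) (auto dest: pos)
    then show ?thesis using sum_list_filter_split[of snd ps "\<lambda>p. snd p > \<theta>"]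
      prob_piecesD(3)[OF assms(1)] by linarith
  qed
  finally have "real (length ?H) \<le> 1 / \<theta>" using assms(3) by (simp add: field_simps)
  with 1 have c: "real (card S) / real n \<le> 1 / (\<theta> * real n)"
    using n divide_right_mono[of "real (card S)" "1 / \<theta>" "real n"] by simp
  have "heavy_mass \<theta> ps = (\<Sum>x\<in>{1..n}. mass_at ?H x)"
    unfolding heavy_mass_def using pos by (intro sum_mass_at[symmetric]) auto
  also have "\<dots> = (\<Sum>x\<in>S. mass_at ?H x)"
  proof (rule sum.mono_neutral_right[OF _ S(1)])
    have "mass_at ?H x = 0" if "x \<notin> S" for x
    proof -
      have "fst p \<noteq> x" if "p \<in> set ?H" for p using that \<open>x \<notin> S\<close> by (auto simp: S_def)
      then have "mass_at ?H x = (\<Sum>p\<leftarrow>?H. 0)"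
        unfolding mass_at_def by (intro arg_cong[where f=sum_list] map_cong) auto
      then show ?thesis by simp
    qed
    then show "\<forall>i\<in>{1..n} - S. mass_at ?H i = 0" by auto
  qed simp
  also have "\<dots> \<le> (\<Sum>x\<in>S. mass_at ps x)"
  proof (rule sum_mono)
    fix x
    have "mass_at (filter (\<lambda>p. \<not> snd p > \<theta>) ps) x \<ge> 0" by (simp_all add: mass_at_filter_nonneg[OF assms(1)])
    then show "mass_at ?H x \<le> mass_at ps x"
      unfolding mass_at_filter_split[of ps x "\<lambda>p. snd p > \<theta>"] by simp
  qed
  finally have h: "heavy_mass \<theta> ps \<le> (\<Sum>x\<in>S. mass_at ps x)" .
  let ?v = "\<lambda>x. mass_at ps x - 1 / real n"
  \<comment> \<open>The deviation has total zero, so its sum over \<open>S\<close> is the negative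
    of that over the complement and hence at most half of the sum of absolute values.\<close>
  have "(\<Sum>x\<in>{1..n}. ?v x) = 0"
    using prob_piecesD(4)[OF assms(1)] n by (simp add: sum_subtractf)
  then have z: "(\<Sum>x\<in>S. ?v x) + (\<Sum>x\<in>{1..n} - S. ?v x) = 0"
    using sum.subset_diff[OF S(1), of ?v] by simp
  have "(\<Sum>x\<in>{1..n}. \<bar>?v x\<bar>) = (\<Sum>x\<in>S. \<bar>?v x\<bar>) + (\<Sum>x\<in>{1..n} - S. \<bar>?v x\<bar>)"
    using sum.subset_diff[OF S(1), of "\<lambda>x. \<bar>?v x\<bar>"] by simp
  moreover have "(\<Sum>x\<in>S. ?v x) \<le> (\<Sum>x\<in>S. \<bar>?v x\<bar>)" by (rule sum_mono) simp
  moreover have "- (\<Sum>x\<in>{1..n} - S. ?v x) \<le> (\<Sum>x\<in>{1..n} - S. \<bar>?v x\<bar>)"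
    unfolding sum_negf[symmetric] by (rule sum_mono) simp
  ultimately have "(\<Sum>x\<in>S. ?v x) \<le> tv_norm n ?v" using z by (simp add: tv_norm_def)
  moreover have "(\<Sum>x\<in>S. ?v x) = (\<Sum>x\<in>S. mass_at ps x) - real (card S) / real n"
    by (simp add: sum_subtractf)
  ultimately show ?thesis using h c by linarith
qed

text \<open>Chebyshev's inequality for a list with weights \<open>w\<close>: on the selected entries
  \<open>b^2 \<le> (g p)^2\<close>.\<close>

lemma sum_list_chebyshev:
  fixes w g :: "'a \<Rightarrow> real"
  assumes "b > 0" "\<And>p. p \<in> set ps \<Longrightarrow> w p \<ge> 0" "\<And>p. p \<in> set ps \<Longrightarrow> P p \<Longrightarrow> \<bar>g p\<bar> \<ge> b"
  shows "(\<Sum>p\<leftarrow>filter P ps. w p) \<le> (\<Sum>p\<leftarrow>ps. w p * (g p)\<^sup>2) / b\<^sup>2"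
proof -
  have "(\<Sum>p\<leftarrow>filter P ps. w p) * b\<^sup>2 = (\<Sum>p\<leftarrow>filter P ps. w p * b\<^sup>2)" by (simp add: sum_list_mult_const)
  also have "\<dots> \<le> (\<Sum>p\<leftarrow>filter P ps. w p * (g p)\<^sup>2)"
  proof (rule sum_list_mono)
    fix p assume "p \<in> set (filter P ps)"
    then have "b \<le> \<bar>g p\<bar>" "w p \<ge> 0" using assms by auto
    moreover from this have "b\<^sup>2 \<le> (g p)\<^sup>2" using assms(1) power_mono[of b "\<bar>g p\<bar>" 2] by simp
    ultimately show "w p * b\<^sup>2 \<le> w p * (g p)\<^sup>2" by (intro mult_left_mono) auto
  qed
  also have "\<dots> \<le> (\<Sum>p\<leftarrow>ps. w p * (g p)\<^sup>2)"
  proof -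
    have "(\<Sum>p\<leftarrow>filter (\<lambda>p. \<not> P p) ps. w p * (g p)\<^sup>2) \<ge> 0"
      using assms(2) by (intro sum_list_nonneg) auto
    then show ?thesis using sum_list_filter_split[of "\<lambda>p. w p * (g p)\<^sup>2" ps P] by linarith
  qed
  finally show ?thesis using assms(1) by (simp add: field_simps)
qed

section \<open>Bounds for the expected distance at a fixed time\<close>

context block_average
begin

definition mean_tv :: "nat \<Rightarrow> nat \<Rightarrow> real" where
  "mean_tv x0 t = measure_pmf.expectation (piece_law x0 t) (\<lambda>ps. tv_norm n (\<lambda>x. mass_at ps x - 1 / real n))"

text \<open>With threshold \<open>\<delta> / n\<close>, a heavy piece has
  \<open>- ln w < ln n + ln (1 / \<delta>)\<close> and so lies at least \<open>b\<close> below the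
  mean \<open>t * log_rate\<close>. Chebyshev's inequality bounds the heavy mass, and
  \<open>expectation_collisions\<close> handles the light part.\<close>

lemma mean_tv_le:
  assumes "x0 \<in> {1..n}" "\<delta> > 0" "\<alpha> > 0" "b > 0"
    "real t * log_rate \<ge> ln (real n) + ln (1 / \<delta>) + b"
  shows "mean_tv x0 t \<le> (\<alpha> / 2 + real t * log_sq_rate / b\<^sup>2 + (\<delta> + 2 * (real t * log_sq_rate / b\<^sup>2)) / (2 * \<alpha>)) / 2"
proof -
  let ?E = "measure_pmf.expectation (piece_law x0 t)"
  let ?Q = "\<lambda>ps. (\<Sum>x\<in>{1..n}. (mass_at ps x)\<^sup>2) - (\<Sum>p\<leftarrow>ps. (snd p)\<^sup>2)"
  let ?V = "\<lambda>ps. (\<Sum>p\<leftarrow>ps. snd p * (- ln (snd p) - real t * log_rate)\<^sup>2)"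
  let ?h = "real t * log_sq_rate / b\<^sup>2"
  let ?H = "heavy_mass (\<delta> / real n)"
  have n: "real n > 0" using n2 by simp
  have H: "?E ?H \<le> ?h"
  proof -
    have "?E ?H \<le> ?E (\<lambda>ps. ?V ps / b\<^sup>2)"
    proof (rule expectation_mono_finite[OF finite_piece_law])
      fix ps assume "ps \<in> set_pmf (piece_law x0 t)"
      then have ps: "prob_pieces n ps" by (rule prob_pieces_piece_law[OF assms(1)])
      show "?H ps \<le> ?V ps / b\<^sup>2"
        unfolding heavy_mass_def
      proof (rule sum_list_chebyshev[OF assms(4)])
        fix p assume p: "p \<in> set ps" "snd p > \<delta> / real n"
        have "\<delta> / real n > 0" using assms n by simp
        with p(2) have "ln (\<delta> / real n) < ln (snd p)" by simp
        then have "- ln (snd p) \<le> ln (real n) + ln (1 / \<delta>)" using n assms(2) by (simp add: ln_div)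
        then show "b \<le> \<bar>- ln (snd p) - real t * log_rate\<bar>" using assms by linarith
      qed (use prob_piecesD(2)[OF ps] in \<open>auto intro: less_imp_le\<close>)
    qed
    also have "\<dots> = ?E ?V / b\<^sup>2" by simp
    also have "\<dots> \<le> ?h" by (intro divide_right_mono log_weight_variance assms) simp
    finally show ?thesis .
  qed
  have "mean_tv x0 t \<le> ?E (\<lambda>ps. (?H ps + \<alpha> / 2 + (real n * (\<delta> / real n)
     + real n * ?Q ps + 2 * ?H ps - 1) / (2 * \<alpha>)) / 2)"
    unfolding mean_tv_def using n2 assms n
    by (intro expectation_mono_finite[OF finite_piece_law] tv_norm_le prob_pieces_piece_law[OF assms(1)]) auto
  also have "\<dots> = ?E (\<lambda>ps. (1/2 + 1 / (2*\<alpha>)) * ?H ps + (real n / (4 * \<alpha>) * ?Q ps + (\<alpha> / 4 + (\<delta> - 1) / (4 * \<alpha>))))"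
    using n assms(3) by (intro expectation_cong_pmf) (simp add: field_simps)
  also have "\<dots> = ?E (\<lambda>ps. (1/2 + 1 / (2*\<alpha>)) * ?H ps) + ?E (\<lambda>ps. real n / (4 * \<alpha>) * ?Q ps + (\<alpha> / 4 + (\<delta> - 1) / (4 * \<alpha>)))"
    by (rule Bochner_Integration.integral_add; rule integrable_piece_law)
  also have "\<dots> = (1/2 + 1 / (2*\<alpha>)) * ?E ?H + (real n / (4 * \<alpha>) * ?E ?Q + (\<alpha> / 4 + (\<delta> - 1) / (4 * \<alpha>)))"
    unfolding expectation_affine[OF finite_piece_law] by simp
  \<comment> \<open>The collision bound contributes \<open>1 / (4 * \<alpha>)\<close>, which cancels
    the \<open>- 1\<close> in \<open>(\<delta> - 1) / (4 * \<alpha>)\<close> exactly and leaves a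
    bound that can be made small.\<close>
  also have "\<dots> \<le> (1/2 + 1 / (2*\<alpha>)) * ?h + (real n / (4 * \<alpha>) * (1 / real n) + (\<alpha> / 4 + (\<delta> - 1) / (4 * \<alpha>)))"
    using assms by (intro add_mono mult_left_mono H expectation_collisions) auto
  also have "\<dots> = (\<alpha> / 2 + ?h + (\<delta> + 2 * ?h) / (2 * \<alpha>)) / 2"
  proof -
    have "(1/2 + 1 / (2*\<alpha>)) * h + (real n / (4 * \<alpha>) * (1 / real n) + (\<alpha> / 4 + (\<delta> - 1) / (4 * \<alpha>)))
      = (\<alpha> / 2 + h + (\<delta> + 2 * h) / (2 * \<alpha>)) / 2" for h
      using n assms(3) by (simp add: field_simps)
    then show ?thesis .
  qed
  finally show ?thesis .
qed

text \<open>Here the light pieces are the atypical ones: their \<open>- ln w\<close> exceeds the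
  mean by at least \<open>b\<close>, so by Chebyshev's inequality most of the mass is heavy and
  \<open>tv_norm_ge\<close> applies.\<close>

lemma mean_tv_ge:
  assumes "x0 \<in> {1..n}" "\<delta> > 0" "b > 0"
    "real t * log_rate + b \<le> ln (real n) - ln (1 / \<delta>)"
  shows "1 - real t * log_sq_rate / b\<^sup>2 - \<delta> \<le> mean_tv x0 t"
proof -
  let ?E = "measure_pmf.expectation (piece_law x0 t)"
  let ?V = "\<lambda>ps. (\<Sum>p\<leftarrow>ps. snd p * (- ln (snd p) - real t * log_rate)\<^sup>2)"
  \<comment> \<open>At this threshold the heavy pieces occupy sites of uniform mass at most
    \<open>1 / (\<theta> * n) = \<delta>\<close>.\<close>
  define \<theta> where "\<theta> = 1 / (\<delta> * real n)"
  have n: "real n > 0" using n2 by simp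
  have \<theta>: "\<theta> > 0" using n assms by (simp add: \<theta>_def)
  have "1 - real t * log_sq_rate / b\<^sup>2 - \<delta> \<le> (- 1 / b\<^sup>2) * ?E ?V + (1 - \<delta>)"
    using divide_right_mono[OF log_weight_variance[OF assms(1), of t], of "b\<^sup>2"] by simp
  also have "\<dots> = ?E (\<lambda>ps. (- 1 / b\<^sup>2) * ?V ps + (1 - \<delta>))"
    by (rule expectation_affine[OF finite_piece_law, symmetric])
  also have "\<dots> \<le> mean_tv x0 t"
    unfolding mean_tv_def
  proof (rule expectation_mono_finite[OF finite_piece_law])
    fix ps assume "ps \<in> set_pmf (piece_law x0 t)"
    then have ps: "prob_pieces n ps" by (rule prob_pieces_piece_law[OF assms(1)])
    have "(\<Sum>p\<leftarrow>filter (\<lambda>p. \<not> snd p > \<theta>) ps. snd p) \<le> ?V ps / b\<^sup>2"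
    proof (rule sum_list_chebyshev[OF assms(3)])
      fix p assume p: "p \<in> set ps" "\<not> snd p > \<theta>"
      have "snd p > 0" by (rule prob_piecesD(2)[OF ps p(1)])
      then have "ln (snd p) \<le> ln \<theta>" using p(2) by simp
      then have "- ln (snd p) \<ge> ln (real n) - ln (1 / \<delta>)" using n assms(2) by (simp add: \<theta>_def ln_div ln_mult)
      then show "b \<le> \<bar>- ln (snd p) - real t * log_rate\<bar>" using assms by linarith
    qed (use prob_piecesD(2)[OF ps] in \<open>auto intro: less_imp_le\<close>)
    then have "1 - ?V ps / b\<^sup>2 \<le> heavy_mass \<theta> ps"
      using sum_list_filter_split[of snd ps "\<lambda>p. snd p > \<theta>"] prob_piecesD(3)[OF ps]
      unfolding heavy_mass_def by linarith
    moreover have "1 / (\<theta> * real n) = \<delta>" using n assms(2) by (simp add: \<theta>_def)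
    ultimately show "(- 1 / b\<^sup>2) * ?V ps + (1 - \<delta>) \<le> tv_norm n (\<lambda>x. mass_at ps x - 1 / real n)"
      using tv_norm_ge[OF ps _ \<theta>] n2 by simp
  qed
  finally show ?thesis .
qed

end

section \<open>The block process and its mixing window\<close>

lemma pieces_cong:
  "(\<And>s. 1 \<le> s \<Longrightarrow> s \<le> t \<Longrightarrow> A s = B s) \<Longrightarrow> pieces x0 A t = pieces x0 B t"
  by (induction t) auto

lemma block_process_cong:
  "(\<And>s. 1 \<le> s \<Longrightarrow> s \<le> t \<Longrightarrow> A s = B s) \<Longrightarrow> block_process \<eta> A t = block_process \<eta> B t"
  by (induction t) auto

text \<open>Outside \<open>I\<close>, samples of \<open>Pi_pmf\<close> have the value
  \<open>d\<close> while points of \<open>Pi\<^sub>M\<close> are \<open>undefined\<close>;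
  restriction reconciles the two, and the measures agree on boxes.\<close>

lemma PiM_measure_pmf_eq_distr_Pi_pmf:
  assumes "finite I"
  shows "Pi\<^sub>M I (\<lambda>_. measure_pmf p) =
    distr (measure_pmf (Pi_pmf I d (\<lambda>_. p))) (Pi\<^sub>M I (\<lambda>_. measure_pmf p)) (\<lambda>f. restrict f I)"
proof -
  interpret product_sigma_finite "\<lambda>_. measure_pmf p"
    by standard
  have m: "(\<lambda>f. restrict f I) \<in> measurable (measure_pmf (Pi_pmf I d (\<lambda>_. p))) (Pi\<^sub>M I (\<lambda>_. measure_pmf p))"
    by (auto simp: space_PiM)
  show ?thesis
  proof (rule PiM_eqI[OF assms, symmetric])
    fix A assume A: "\<And>i. i \<in> I \<Longrightarrow> A i \<in> sets (measure_pmf p)"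
    have "emeasure (distr (measure_pmf (Pi_pmf I d (\<lambda>_. p))) (Pi\<^sub>M I (\<lambda>_. measure_pmf p)) (\<lambda>f. restrict f I)) (Pi\<^sub>E I A)
      = emeasure (measure_pmf (Pi_pmf I d (\<lambda>_. p))) ((\<lambda>f. restrict f I) -` Pi\<^sub>E I A)"
      using assms A by (subst emeasure_distr[OF m]) (auto intro!: sets_PiM_I_finite)
    also have "(\<lambda>f. restrict f I) -` Pi\<^sub>E I A = Pi I A"
      by (auto simp: PiE_def Pi_def)
    also have "emeasure (measure_pmf (Pi_pmf I d (\<lambda>_. p))) (Pi I A) = (\<Prod>i\<in>I. emeasure (measure_pmf p) (A i))"
      by (simp add: measure_pmf.emeasure_eq_measure measure_Pi_pmf_Pi assms prod_ennreal)
    finally show "emeasure (distr (measure_pmf (Pi_pmf I d (\<lambda>_. p))) (Pi\<^sub>M I (\<lambda>_. measure_pmf p)) (\<lambda>f. restrict f I)) (Pi\<^sub>E I A)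
      = (\<Prod>i\<in>I. emeasure (measure_pmf p) (A i))" .
  qed simp
qed

context block_average
begin

text \<open>The block at time \<open>Suc t\<close> is independent of the earlier ones, and the
  pieces at time \<open>t\<close> do not depend on it.\<close>

lemma piece_law_eq_map_Pi_pmf:
  "piece_law x0 t = map_pmf (\<lambda>A. pieces x0 A t) (Pi_pmf {1..t} {} (\<lambda>_. block_law n X))"
proof (induction t)
  case (Suc t)
  let ?P = "Pi_pmf {1..t} {} (\<lambda>_. block_law n X)"
  have *: "pieces x0 (f(Suc t := B)) (Suc t) = split_pieces B (pieces x0 f t)" for f B
    using pieces_cong[of t "f(Suc t := B)" f] by simp
  have "{1..Suc t} = insert (Suc t) {1..t}" by auto
  then have "map_pmf (\<lambda>A. pieces x0 A (Suc t)) (Pi_pmf {1..Suc t} {} (\<lambda>_. block_law n X)) =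
     map_pmf (\<lambda>(B, f). split_pieces B (pieces x0 f t)) (pair_pmf (block_law n X) ?P)"
    by (simp only: Pi_pmf_insert finite_atLeastAtMost atLeastAtMost_iff)
       (simp add: Pi_pmf_insert map_pmf_comp case_prod_unfold * del: pieces.simps)
  also have "\<dots> = map_pmf (\<lambda>(f, B). split_pieces B (pieces x0 f t)) (pair_pmf ?P (block_law n X))"
    by (subst pair_commute_pmf) (simp add: map_pmf_comp case_prod_unfold)
  also have "\<dots> = piece_law x0 (Suc t)"
    by (simp add: Suc pair_pmf_def map_bind_pmf bind_map_pmf map_pmf_def[of _ "block_law n X"])
  finally show ?case by simp
qed simp

text \<open>The distance at time \<open>t\<close> depends on the first \<open>t\<close> blocks only,
  so the integral passes to the finite product, then to \<open>Pi_pmf\<close> and to the chain of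
  pieces.\<close>

lemma integral_d_TV:
  "(\<integral>A. d_TV n x0 A t \<partial>block_space n X) = mean_tv x0 t"
proof -
  let ?p = "block_law n X"
  let ?M = "\<lambda>_::nat. measure_pmf ?p"
  interpret product_prob_space ?M "{1..}"
    by standard
  \<comment> \<open>Measurability is known for functions of whole block sequences.
    \<open>ext\<close> turns a finite sequence into one by adding empty blocks after time
    \<open>t\<close>, which leaves the process up to \<open>t\<close> unchanged.\<close>
  define ext where "ext A = (\<lambda>s\<in>{1..}. if s \<le> t then A s else {})" for A :: "nat \<Rightarrow> nat set"
  have d: "d_TV n x0 (ext (restrict A {1..t})) t = d_TV n x0 A t" for A
  proof -
    have "block_process (dirac x0) (ext (restrict A {1..t})) t = block_process (dirac x0) A t"
      by (rule block_process_cong) (auto simp: ext_def)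
    then show ?thesis by (simp add: d_TV_def)
  qed
  have e: "ext \<in> measurable (Pi\<^sub>M {1..t} ?M) (block_space n X)"
    unfolding ext_def block_space_def
  proof (rule measurable_restrict)
    fix s :: nat assume "s \<in> {1..}"
    then show "(\<lambda>A. if s \<le> t then A s else {}) \<in> measurable (Pi\<^sub>M {1..t} ?M) (measure_pmf ?p)"
      by (cases "s \<le> t") (auto intro!: measurable_component_singleton)
  qed
  have f: "(\<lambda>A. d_TV n x0 (ext A) t) \<in> borel_measurable (Pi\<^sub>M {1..t} ?M)"
    by (rule measurable_compose[OF e measurable_d_TV])
  have r: "(\<lambda>A. restrict A {1..t}) \<in> measurable (block_space n X) (Pi\<^sub>M {1..t} ?M)"
    unfolding block_space_def by (rule measurable_restrict_subset) auto
  have "(\<integral>A. d_TV n x0 A t \<partial>block_space n X) = (\<integral>A. d_TV n x0 (ext (restrict A {1..t})) t \<partial>block_space n X)"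
    by (simp only: d)
  also have "\<dots> = (\<integral>A. d_TV n x0 (ext A) t \<partial>distr (block_space n X) (Pi\<^sub>M {1..t} ?M) (\<lambda>A. restrict A {1..t}))"
    by (rule integral_distr[OF r f, symmetric])
  also have "distr (block_space n X) (Pi\<^sub>M {1..t} ?M) (\<lambda>A. restrict A {1..t}) = Pi\<^sub>M {1..t} ?M"
    unfolding block_space_def by (rule distr_PiM_restrict_finite) auto
  also have "\<dots> = distr (measure_pmf (Pi_pmf {1..t} {} (\<lambda>_. ?p))) (Pi\<^sub>M {1..t} ?M) (\<lambda>A. restrict A {1..t})"
    by (rule PiM_measure_pmf_eq_distr_Pi_pmf) simp
  also have "(\<integral>A. d_TV n x0 (ext A) t \<partial>\<dots>) =
    measure_pmf.expectation (Pi_pmf {1..t} {} (\<lambda>_. ?p)) (\<lambda>A. d_TV n x0 (ext (restrict A {1..t})) t)"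
    by (rule integral_distr[OF _ f]) (auto simp: space_PiM)
  also have "\<dots> = measure_pmf.expectation (Pi_pmf {1..t} {} (\<lambda>_. ?p))
      (\<lambda>A. tv_norm n (\<lambda>x. mass_at (pieces x0 A t) x - 1 / real n))"
  proof (rule expectation_cong_pmf)
    \<comment> \<open>On the support each of the first \<open>t\<close> blocks is finite and
      nonempty, as needed to identify the process with the site masses.\<close>
    fix A assume "A \<in> set_pmf (Pi_pmf {1..t} {} (\<lambda>_. ?p))"
    then have "A s \<in> set_pmf ?p" if "1 \<le> s" "s \<le> t" for s
      using that by (auto simp: set_Pi_pmf PiE_dflt_def)
    then have "finite (A s) \<and> A s \<noteq> {}" if "1 \<le> s" "s \<le> t" for s
      using that set_block_law[of "A s"] by auto
    then have "block_process (dirac x0) A t = mass_at (pieces x0 A t)"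
      by (rule block_process_eq_mass_at)
    then show "d_TV n x0 (ext (restrict A {1..t})) t = tv_norm n (\<lambda>x. mass_at (pieces x0 A t) x - 1 / real n)"
      unfolding d by (simp add: d_TV_def)
  qed
  also have "\<dots> = mean_tv x0 t"
    by (simp add: mean_tv_def piece_law_eq_map_Pi_pmf)
  finally show ?thesis .
qed

lemma t_mix_eq: "t_mix n X x0 \<epsilon> = Inf {t. mean_tv x0 t < \<epsilon>}"
  by (simp add: t_mix_def integral_d_TV)

section \<open>Rates and window in terms of \<open>mu_Y\<close> and \<open>sigma_Y\<close>\<close>

lemma mean_gt_0: "mean X > 0"
  using mean_bounds by simp

lemma log_rate_eq: "log_rate = mean X * mu_Y X / real n"
  using mean_gt_0 by (simp add: log_rate_def mu_Y_def expectation_size_biased[OF n2 X_range])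

lemma finite_size_biased: "finite (set_pmf (size_biased X))"
proof (rule finite_subset[OF _ finite_X])
  show "set_pmf (size_biased X) \<subseteq> set_pmf X"
    by (auto simp: set_pmf_iff pmf_size_biased[OF n2 X_range])
qed

lemma integrable_size_biased [simp]: "integrable (measure_pmf (size_biased X)) (f :: _ \<Rightarrow> real)"
  by (rule integrable_measure_pmf_finite[OF finite_size_biased])

lemma set_size_biased: "k \<in> set_pmf (size_biased X) \<Longrightarrow> 2 \<le> k \<and> k \<le> n"
  using X_range by (auto simp: set_pmf_iff pmf_size_biased[OF n2 X_range])

lemma sigma_sq: "(sigma_Y X)\<^sup>2 = measure_pmf.expectation (size_biased X) (\<lambda>k. (ln (real k))\<^sup>2) - (mu_Y X)\<^sup>2"
proof -
  have "0 \<le> measure_pmf.variance (size_biased X) (\<lambda>k. ln (real k))"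
    by (rule measure_pmf.variance_positive)
  then show ?thesis
    unfolding sigma_Y_def by (simp add: measure_pmf.variance_eq mu_Y_def)
qed

lemma log_sq_rate_eq: "log_sq_rate = mean X * ((sigma_Y X)\<^sup>2 + (mu_Y X)\<^sup>2) / real n"
  using mean_gt_0 by (simp add: log_sq_rate_def sigma_sq expectation_size_biased[OF n2 X_range])

lemma mu_bounds: "1 / 2 \<le> mu_Y X" "mu_Y X \<le> ln (real n)"
proof -
  have "measure_pmf.expectation (size_biased X) (\<lambda>_. ln 2) \<le> measure_pmf.expectation (size_biased X) (\<lambda>k. ln (real k))"
    using set_size_biased by (intro expectation_mono_finite finite_size_biased) force
  then show "1 / 2 \<le> mu_Y X" using ln2_ge_two_thirds by (simp add: mu_Y_def)
  have "measure_pmf.expectation (size_biased X) (\<lambda>k. ln (real k)) \<le> measure_pmf.expectation (size_biased X) (\<lambda>_. ln (real n))"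
    using set_size_biased by (intro expectation_mono_finite finite_size_biased) force
  then show "mu_Y X \<le> ln (real n)" by (simp add: mu_Y_def)
qed

lemma sigma_nonneg: "0 \<le> sigma_Y X"
  unfolding sigma_Y_def by (simp add: measure_pmf.variance_positive)

text \<open>The window on the logarithmic scale: the distance that the mean of \<open>- ln w\<close>
  travels in time \<open>t_w\<close>.\<close>

definition "gap = log_rate * t_w n X"

lemma log_rate_pos: "log_rate > 0"
  using mean_gt_0 mu_bounds n2 by (simp add: log_rate_eq)

lemma log_rate_t_ent: "log_rate * t_ent n X = ln (real n)"
  using mean_gt_0 mu_bounds n2 by (simp add: log_rate_eq t_ent_eq[OF n2 X_range])

lemma gap_eq: "gap = (mu_Y X + sigma_Y X) * sqrt (ln (real n) / mu_Y X)"
proof -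
  have "mu_Y X > 0" using mu_bounds by simp
  then show ?thesis
    using mean_gt_0 n2 by (simp add: gap_def log_rate_eq t_w_def real_sqrt_divide field_simps)
qed

lemma gap_ge: "1 / 2 \<le> gap"
proof -
  have "1 \<le> sqrt (ln (real n) / mu_Y X)" using mu_bounds by (simp add: field_simps)
  then have "(1/2) * 1 \<le> (mu_Y X + sigma_Y X) * sqrt (ln (real n) / mu_Y X)"
    using mu_bounds sigma_nonneg by (intro mult_mono) auto
  then show ?thesis by (simp add: gap_eq)
qed

text \<open>This explains the form of \<open>t_w\<close>: the fluctuation accumulated by the
  entropic time is at most one \<open>gap\<close>, because
  \<open>sigma^2 + mu^2 \<le> (mu + sigma)^2\<close>.\<close>

lemma t_ent_log_sq_rate: "t_ent n X * log_sq_rate \<le> gap\<^sup>2"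
proof -
  have mu: "mu_Y X > 0" using mu_bounds by simp
  have "t_ent n X * log_sq_rate = ln (real n) / mu_Y X * ((sigma_Y X)\<^sup>2 + (mu_Y X)\<^sup>2)"
    using mean_gt_0 n2 by (simp add: t_ent_eq[OF n2 X_range] log_sq_rate_eq)
  also have "\<dots> \<le> ln (real n) / mu_Y X * (mu_Y X + sigma_Y X)\<^sup>2"
    using n2 mu sigma_nonneg by (intro mult_left_mono) (auto simp: power2_sum)
  also have "\<dots> = gap\<^sup>2"
    using n2 mu by (simp add: gap_eq power_mult_distrib)
  finally show ?thesis .
qed

lemma log_sq_rate_nonneg: "log_sq_rate \<ge> 0"
  using mean_gt_0 by (simp add: log_sq_rate_eq)

lemma t_ent_pos: "t_ent n X > 0"
  using mean_gt_0 mu_bounds n2 by (simp add: t_ent_eq[OF n2 X_range])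

text \<open>Both \<open>n / mean X\<close> and \<open>ln n / mu_Y X\<close> are at least one. The
  bound lets the window absorb the rounding of times to integers.\<close>

lemma t_w_ge_1: "1 \<le> t_w n X"
proof -
  have mu: "mu_Y X > 0" using mu_bounds by simp
  have "1 * (1 * 1) \<le> (1 + sigma_Y X / mu_Y X) * (real n / mean X * sqrt (ln (real n) / mu_Y X))"
    using mu mu_bounds sigma_nonneg mean_bounds mean_gt_0 by (intro mult_mono) auto
  then show ?thesis by (simp add: t_w_def real_sqrt_divide)
qed

section \<open>The expected distance outside the window\<close>

lemma mean_tv_after:
  assumes "x0 \<in> {1..n}" "0 < \<delta>" "\<delta> < 1" "0 < \<alpha>" "C \<ge> 4 * ln (1 / \<delta>)" "C > 0" "8 / C\<^sup>2 \<le> \<delta>"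
    and "t_ent n X + C * t_w n X \<le> real t" "real t \<le> 2 * t_ent n X"
  shows "mean_tv x0 t \<le> (\<alpha> / 2 + \<delta> + 3 * \<delta> / (2 * \<alpha>)) / 2"
proof -
  \<comment> \<open>The mean of \<open>- ln w\<close> is at least \<open>C * gap\<close> beyond
    \<open>ln n\<close>. One half of this covers \<open>ln (1 / \<delta>)\<close>, since
    \<open>gap \<ge> 1 / 2\<close> and \<open>C \<ge> 4 * ln (1 / \<delta>)\<close>; the other half
    is the Chebyshev distance.\<close>
  define b where "b = C * gap / 2"
  define h where "h = real t * log_sq_rate / b\<^sup>2"
  have b: "b > 0" using gap_ge assms by (simp add: b_def)
  have "ln (1 / \<delta>) \<le> C / 4" using assms by simp
  also have "\<dots> \<le> b" unfolding b_def using gap_ge assms(6) mult_left_mono[OF gap_ge, of C] by simp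
  finally have l: "ln (1 / \<delta>) \<le> b" .
  have "log_rate * (t_ent n X + C * t_w n X) \<le> log_rate * real t"
    using log_rate_pos assms by (intro mult_left_mono) auto
  then have "ln (real n) + 2 * b \<le> real t * log_rate"
    using log_rate_t_ent by (simp add: b_def gap_def algebra_simps)
  with l have 1: "ln (real n) + ln (1 / \<delta>) + b \<le> real t * log_rate" by linarith
  have "real t * log_sq_rate \<le> 2 * t_ent n X * log_sq_rate"
    using assms log_sq_rate_nonneg by (intro mult_right_mono) auto
  also have "\<dots> \<le> 2 * gap\<^sup>2" using t_ent_log_sq_rate by simp
  finally have "h \<le> 2 * gap\<^sup>2 / b\<^sup>2" unfolding h_def using b by (intro divide_right_mono) auto
  also have "\<dots> = 8 / C\<^sup>2" using gap_ge assms by (simp add: b_def power2_eq_square field_simps)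
  finally have h: "h \<le> \<delta>" using assms by simp
  have "mean_tv x0 t \<le> (\<alpha> / 2 + h + (\<delta> + 2 * h) / (2 * \<alpha>)) / 2"
    unfolding h_def by (rule mean_tv_le[OF assms(1,2,4) b 1])
  also have "\<dots> \<le> (\<alpha> / 2 + \<delta> + 3 * \<delta> / (2 * \<alpha>)) / 2"
    using h assms by (intro divide_right_mono add_mono) auto
  finally show ?thesis .
qed

lemma mean_tv_before:
  assumes "x0 \<in> {1..n}" "0 < \<delta>" "\<delta> < 1" "C \<ge> 4 * ln (1 / \<delta>)" "C > 0" "8 / C\<^sup>2 \<le> \<delta>"
    and "real t \<le> t_ent n X - C * t_w n X"
  shows "1 - 2 * \<delta> \<le> mean_tv x0 t"
proof -
  define b where "b = C * gap / 2"
  define h where "h = real t * log_sq_rate / b\<^sup>2"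
  have b: "b > 0" using gap_ge assms by (simp add: b_def)
  have "ln (1 / \<delta>) \<le> C / 4" using assms by simp
  also have "\<dots> \<le> b" unfolding b_def using gap_ge assms(5) mult_left_mono[OF gap_ge, of C] by simp
  finally have l: "ln (1 / \<delta>) \<le> b" .
  have "log_rate * real t \<le> log_rate * (t_ent n X - C * t_w n X)"
    using log_rate_pos assms by (intro mult_left_mono) auto
  then have "real t * log_rate + 2 * b \<le> ln (real n)"
    using log_rate_t_ent by (simp add: b_def gap_def algebra_simps)
  with l have 1: "real t * log_rate + b \<le> ln (real n) - ln (1 / \<delta>)" by linarith
  have "real t \<le> t_ent n X" using assms t_w_ge_1 mult_pos_pos[of C "t_w n X"] by linarith
  then have "real t * log_sq_rate \<le> t_ent n X * log_sq_rate"
    using log_sq_rate_nonneg by (intro mult_right_mono) auto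
  \<comment> \<open>The spare factor two brings the estimate under the same condition
    \<open>8 / C^2 \<le> \<delta>\<close> as in \<open>mean_tv_after\<close>.\<close>
  also have "\<dots> \<le> 2 * gap\<^sup>2" using t_ent_log_sq_rate zero_le_power2[of gap] by linarith
  finally have "h \<le> 2 * gap\<^sup>2 / b\<^sup>2" unfolding h_def using b by (intro divide_right_mono) auto
  also have "\<dots> = 8 / C\<^sup>2" using gap_ge assms by (simp add: b_def power2_eq_square field_simps)
  finally have h: "h \<le> \<delta>" using assms by simp
  have "1 - h - \<delta> \<le> mean_tv x0 t" unfolding h_def by (rule mean_tv_ge[OF assms(1,2) b 1])
  with h show ?thesis by linarith
qed

text \<open>The last assumption places \<open>t_ent + C * t_w\<close>, even after rounding up, below
  \<open>2 * t_ent\<close>, where \<open>mean_tv_after\<close> applies.\<close>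

lemma t_mix_window:
  assumes "x0 \<in> {1..n}" "0 < \<epsilon>" "\<epsilon> < 1 / 2" "\<delta> = \<epsilon>\<^sup>2 / 3"
    "C \<ge> 4 * ln (1 / \<delta>)" "C > 0" "8 / C\<^sup>2 \<le> \<delta>"
    and "(C + 1) * t_w n X \<le> t_ent n X"
  shows "\<bar>(real (t_mix n X x0 \<epsilon>) - real (t_mix n X x0 (1 - \<epsilon>))) / t_w n X\<bar> \<le> 2 * C + 1"
proof -
  let ?w = "t_w n X" and ?T = "t_ent n X"
  have "\<epsilon> * \<epsilon> < \<epsilon> * (1 / 2)" using assms by (intro mult_strict_left_mono) auto
  moreover have "\<epsilon> * \<epsilon> > 0" "3 * \<delta> = \<epsilon> * \<epsilon>" using assms(2,4) by (auto simp: power2_eq_square)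
  ultimately have \<delta>: "0 < \<delta>" "\<delta> < 1" "\<delta> < \<epsilon> / 6" using assms(2,3) by linarith+
  define t where "t = nat \<lceil>?T + C * ?w\<rceil>"
  have "?T + C * ?w \<ge> 0" using t_ent_pos t_w_ge_1 assms by simp
  then have t: "?T + C * ?w \<le> real t" "real t \<le> ?T + C * ?w + 1"
    unfolding t_def by linarith+
  have t2: "real t \<le> ?T + (C + 1) * ?w" using t t_w_ge_1 by (simp add: algebra_simps)
  then have "real t \<le> 2 * ?T" using assms by linarith
  then have "mean_tv x0 t \<le> (\<epsilon> / 2 + \<delta> + 3 * \<delta> / (2 * \<epsilon>)) / 2"
    using assms \<delta> t by (intro mean_tv_after[of x0 \<delta> \<epsilon> C]) auto
  \<comment> \<open>The parameter \<open>\<alpha>\<close> was taken to be \<open>\<epsilon>\<close>,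
    and \<open>\<delta> = \<epsilon>^2 / 3\<close> is chosen for this equation; the total bound is
    \<open>(\<epsilon> + \<delta>) / 2\<close>.\<close>
  also have "3 * \<delta> / (2 * \<epsilon>) = \<epsilon> / 2" using assms(2,4) by (simp add: power2_eq_square field_simps)
  finally have "mean_tv x0 t \<le> (\<epsilon> / 2 + \<delta> + \<epsilon> / 2) / 2" .
  then have te: "mean_tv x0 t < \<epsilon>" using \<delta>(3) assms(2) by simp
  let ?A = "{t. mean_tv x0 t < \<epsilon>}" and ?B = "{t. mean_tv x0 t < 1 - \<epsilon>}"
  have tA: "t \<in> ?A" and tB: "t \<in> ?B" using te assms by auto
  have sub: "?A \<subseteq> ?B" using assms by auto
  have a: "t_mix n X x0 \<epsilon> \<le> t" unfolding t_mix_eq using tA by (rule cInf_lower) simp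
  \<comment> \<open>The infimum is attained, so the expected distance at this time is below
    \<open>1 - \<epsilon>\<close>. Before the window it is at least
    \<open>1 - 2 * \<delta> > 1 - \<epsilon>\<close>, so this time cannot lie there.\<close>
  have "t_mix n X x0 (1 - \<epsilon>) \<in> ?B" unfolding t_mix_eq using tB by (intro Inf_nat_def1) auto
  then have "\<not> real (t_mix n X x0 (1 - \<epsilon>)) \<le> ?T - C * ?w"
    using mean_tv_before[of x0 \<delta> C "t_mix n X x0 (1 - \<epsilon>)"] assms \<delta> by force
  with a t2 have u: "real (t_mix n X x0 \<epsilon>) - real (t_mix n X x0 (1 - \<epsilon>)) \<le> (2 * C + 1) * ?w"
    by (simp add: algebra_simps)
  have "t_mix n X x0 (1 - \<epsilon>) \<le> t_mix n X x0 \<epsilon>"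
    unfolding t_mix_eq using tA sub by (intro cInf_superset_mono) auto
  then have "\<bar>real (t_mix n X x0 \<epsilon>) - real (t_mix n X x0 (1 - \<epsilon>))\<bar> \<le> (2 * C + 1) * ?w"
    using u by simp
  then show ?thesis using t_w_ge_1 by (simp add: abs_divide divide_le_eq)
qed

text \<open>The radicands are exactly the two quantities assumed to vanish in the limit.\<close>

lemma t_w_over_t_ent:
  "t_w n X / t_ent n X = sqrt (mu_Y X / ln (real n)) + sqrt ((sigma_Y X)\<^sup>2 / (mu_Y X * ln (real n)))"
proof -
  have mu: "mu_Y X > 0" and l: "ln (real n) > 0" using mu_bounds n2 by auto
  have "t_w n X / t_ent n X = gap / ln (real n)"
    unfolding log_rate_t_ent[symmetric] gap_def using log_rate_pos by simp
  also have "\<dots> = (mu_Y X + sigma_Y X) / (sqrt (mu_Y X) * sqrt (ln (real n)))"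
    using real_sqrt_pow2[of "ln (real n)"] l mu unfolding gap_eq real_sqrt_divide
    by (simp add: field_simps power2_eq_square)
  also have "\<dots> = sqrt (mu_Y X) / sqrt (ln (real n)) + sigma_Y X / (sqrt (mu_Y X) * sqrt (ln (real n)))"
    using real_sqrt_pow2[of "mu_Y X"] l mu by (simp add: field_simps power2_eq_square)
  finally show ?thesis using sigma_nonneg by (simp add: real_sqrt_divide real_sqrt_mult)
qed

end

theorem theorem2p8:
  fixes X :: "nat \<Rightarrow> nat pmf" and x0 :: "nat \<Rightarrow> nat"
  assumes "\<And>n. n \<ge> 2 \<Longrightarrow> set_pmf (X n) \<subseteq> {2..n}"
    and "\<And>n. n \<ge> 2 \<Longrightarrow> x0 n \<in> {1..n}"
    and "(\<lambda>n. mu_Y (X n) / ln (real n)) \<longlonglongrightarrow> 0"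
    and "(\<lambda>n. (sigma_Y (X n))\<^sup>2 / (mu_Y (X n) * ln (real n))) \<longlonglongrightarrow> 0"
  shows "(\<lambda>n. t_w n (X n) / t_ent n (X n)) \<longlonglongrightarrow> 0 \<and>
    (\<forall>\<epsilon>::real. 0 < \<epsilon> \<and> \<epsilon> < 1/2 \<longrightarrow>
      Bseq (\<lambda>n. (real (t_mix n (X n) (x0 n) \<epsilon>) - real (t_mix n (X n) (x0 n) (1 - \<epsilon>)))
                 / t_w n (X n)))"
proof
  have loc: "block_average n (X n)" if "n \<ge> 2" for n
    using that assms(1) by unfold_locales auto
  have ev: "eventually (\<lambda>n::nat. n \<ge> 2) sequentially" by (rule eventually_ge_at_top)
  have "(\<lambda>n. sqrt (mu_Y (X n) / ln (real n)) + sqrt ((sigma_Y (X n))\<^sup>2 / (mu_Y (X n) * ln (real n)))) \<longlonglongrightarrow> sqrt 0 + sqrt 0"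
    by (intro tendsto_add tendsto_real_sqrt assms)
  moreover have "eventually (\<lambda>n. t_w n (X n) / t_ent n (X n) =
      sqrt (mu_Y (X n) / ln (real n)) + sqrt ((sigma_Y (X n))\<^sup>2 / (mu_Y (X n) * ln (real n)))) sequentially"
    using ev by eventually_elim (rule block_average.t_w_over_t_ent[OF loc])
  ultimately show lim: "(\<lambda>n. t_w n (X n) / t_ent n (X n)) \<longlonglongrightarrow> 0"
    by (simp add: tendsto_cong)
  show "\<forall>\<epsilon>::real. 0 < \<epsilon> \<and> \<epsilon> < 1/2 \<longrightarrow>
      Bseq (\<lambda>n. (real (t_mix n (X n) (x0 n) \<epsilon>) - real (t_mix n (X n) (x0 n) (1 - \<epsilon>))) / t_w n (X n))"
  proof (intro allI impI)
    fix \<epsilon> :: real assume \<epsilon>: "0 < \<epsilon> \<and> \<epsilon> < 1/2"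
    define \<delta> where "\<delta> = \<epsilon>\<^sup>2 / 3"
    \<comment> \<open>The first entry pays for \<open>ln (1 / \<delta>)\<close>, the second gives
      \<open>8 / C^2 \<le> \<delta>\<close>; neither depends on \<open>n\<close>.\<close>
    define C where "C = max (4 * ln (1 / \<delta>)) (sqrt (8 / \<delta>))"
    have \<delta>: "\<delta> > 0" using \<epsilon> by (simp add: \<delta>_def)
    have s: "sqrt (8 / \<delta>) > 0" "sqrt (8 / \<delta>) \<le> C" using \<delta> by (auto simp: C_def)
    then have C: "C \<ge> 4 * ln (1 / \<delta>)" "C > 0"
      by (simp add: C_def, linarith)
    have "(sqrt (8 / \<delta>))\<^sup>2 \<le> C\<^sup>2" using s by (intro power_mono) auto
    then have C2: "8 / C\<^sup>2 \<le> \<delta>" using \<delta> C by (simp add: field_simps)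
    \<comment> \<open>The first claim of the theorem supplies the separation of scales required by
      \<open>t_mix_window\<close>.\<close>
    have "eventually (\<lambda>n. t_w n (X n) / t_ent n (X n) < 1 / (C + 1)) sequentially"
      using C by (intro order_tendstoD(2)[OF lim]) auto
    with ev have "eventually (\<lambda>n. norm ((real (t_mix n (X n) (x0 n) \<epsilon>)
        - real (t_mix n (X n) (x0 n) (1 - \<epsilon>))) / t_w n (X n)) \<le> 2 * C + 1) sequentially"
    proof eventually_elim
      case (elim n)
      interpret block_average n "X n" by (rule loc[OF elim(1)])
      have "(C + 1) * t_w n (X n) \<le> t_ent n (X n)"
        using elim(2) C t_ent_pos by (simp add: field_simps)
      then show ?case
        using t_mix_window[OF assms(2)[OF elim(1)] _ _ \<delta>_def C C2] \<epsilon> by (simp only: real_norm_def)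
    qed
    then show "Bseq (\<lambda>n. (real (t_mix n (X n) (x0 n) \<epsilon>) - real (t_mix n (X n) (x0 n) (1 - \<epsilon>))) / t_w n (X n))"
      by (rule BfunI)
  qed
qed

end
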